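(* Let $p_0\ge 3$. Suppose that for every compact $C^2$ hypersurface $S\subset\mathbb{R}^3$ (possibly with boundary) with a strictly positive second fundamental form and every $p>p_0$ there is a constant $C_p$ such that $\|E_Sf\|_{L^p(\mathbb{R}^3)}\le C_p\|f\|_{L^p(d\sigma_S)}$ for all $f\in L^p(S,d\sigma_S)$. Then every Kakeya set in $\mathbb{R}^3$ has Hausdorff dimension at least $$s(p_0)=\frac{6-p_0}{p_0-2}.$$ In particular, $s(22/7)=5/2$ and $s(3.2)=7/3$.
   Context: $E_Sf(x)=\int_S e^{ix\cdot\xi}f(\xi)\,d\sigma_S(\xi)$ is the Fourier extension operator, with $\sigma_S$ the surface measure on $S$. A Kakeya set in $\mathbb{R}^3$ is a compact set containing a unit line segment in every direction. *)

theory Defs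
  imports "HOL-Analysis.Analysis"
begin

section \<open>Hausdorff measure and dimension\<close>

text \<open>
  The case distinction implements the conventions that the empty set costs \<open>0\<close> and that a
  nonempty set costs \<open>1\<close> for \<open>s = 0\<close> (in HOL, \<open>0 powr 0 = 0\<close>).
\<close>

definition diam_cost :: "real \<Rightarrow> 'a::metric_space set \<Rightarrow> ennreal" where
  "diam_cost s A = (if A = {} then 0 else if s = 0 then 1 else ennreal (diameter A powr s))"

text \<open>Boundedness has to be required separately, since \<^term>\<open>diameter A = 0\<close> for unbounded \<open>A\<close>.\<close>

definition hausdorff_content :: "real \<Rightarrow> real \<Rightarrow> 'a::metric_space set \<Rightarrow> ennreal" where
  "hausdorff_content s \<delta> A =
     (INF C \<in> {C :: nat \<Rightarrow> 'a set. (\<forall>n. bounded (C n) \<and> diameter (C n) \<le> \<delta>) \<and> A \<subseteq> (\<Union>n. C n)}.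
        \<Sum>n. diam_cost s (C n))"

definition hausdorff_measure :: "real \<Rightarrow> 'a::metric_space set \<Rightarrow> ennreal" where
  "hausdorff_measure s A = (SUP \<delta> \<in> {0<..}. hausdorff_content s \<delta> A)"

definition hausdorff_dim :: "'a::metric_space set \<Rightarrow> ereal" where
  "hausdorff_dim A = Inf {ereal s | s. 0 \<le> s \<and> hausdorff_measure s A = 0}"


section \<open>Compact \<open>C\<^sup>2\<close> surfaces in three-space\<close>

text \<open>\<open>\<phi>\<close> is of class \<open>C\<^sup>2\<close> on \<open>U\<close>, with first and second derivatives \<open>\<phi>'\<close> and \<open>\<phi>''\<close>.\<close>

definition C2_on ::
  "(real^2) set \<Rightarrow> (real^2 \<Rightarrow> real^3) \<Rightarrow> (real^2 \<Rightarrow> (real^2) \<Rightarrow>\<^sub>L (real^3))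
     \<Rightarrow> (real^2 \<Rightarrow> (real^2) \<Rightarrow>\<^sub>L (real^2) \<Rightarrow>\<^sub>L (real^3)) \<Rightarrow> bool" where
  "C2_on U \<phi> \<phi>' \<phi>'' \<longleftrightarrow>
     (\<forall>u\<in>U. (\<phi> has_derivative blinfun_apply (\<phi>' u)) (at u)) \<and>
     (\<forall>u\<in>U. (\<phi>' has_derivative blinfun_apply (\<phi>'' u)) (at u)) \<and>
     continuous_on U \<phi>''"

definition half_plane :: "(real^2) set" where
  "half_plane = {u. 0 \<le> u $ 1}"

text \<open>
  A local \<open>C\<^sup>2\<close> parametrization of \<open>S\<close>: a \<open>C\<^sup>2\<close> immersion of an open set \<open>U\<close> of the plane which
  maps \<open>U \<inter> H\<close> homeomorphically onto a relatively open subset of \<open>S\<close>.  The model \<open>H\<close> is the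
  whole plane around interior points of \<open>S\<close>, and the closed half-plane around boundary points.
\<close>

definition local_parametrization ::
  "(real^3) set \<Rightarrow> (real^2) set \<Rightarrow> (real^2) set \<Rightarrow> (real^2 \<Rightarrow> real^3)
     \<Rightarrow> (real^2 \<Rightarrow> (real^2) \<Rightarrow>\<^sub>L (real^3)) \<Rightarrow> (real^2 \<Rightarrow> (real^2) \<Rightarrow>\<^sub>L (real^2) \<Rightarrow>\<^sub>L (real^3)) \<Rightarrow> bool" where
  "local_parametrization S U H \<phi> \<phi>' \<phi>'' \<longleftrightarrow>
     open U \<and> (H = UNIV \<or> H = half_plane) \<and>
     C2_on U \<phi> \<phi>' \<phi>'' \<and> (\<forall>u\<in>U. inj (blinfun_apply (\<phi>' u))) \<and>
     (\<exists>\<psi>. homeomorphism (U \<inter> H) (\<phi> ` (U \<inter> H)) \<phi> \<psi>) \<and>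
     openin (top_of_set S) (\<phi> ` (U \<inter> H))"

definition C2_surface :: "(real^3) set \<Rightarrow> bool" where
  "C2_surface S \<longleftrightarrow>
     (\<forall>p\<in>S. \<exists>U H \<phi> \<phi>' \<phi>''. local_parametrization S U H \<phi> \<phi>' \<phi>'' \<and> p \<in> \<phi> ` (U \<inter> H))"

definition unit_normal_field :: "(real^3) set \<Rightarrow> (real^3 \<Rightarrow> real^3) \<Rightarrow> bool" where
  "unit_normal_field S \<nu> \<longleftrightarrow>
     continuous_on S \<nu> \<and> (\<forall>p\<in>S. norm (\<nu> p) = 1) \<and>
     (\<forall>U H \<phi> \<phi>' \<phi>''. local_parametrization S U H \<phi> \<phi>' \<phi>'' \<longrightarrow>
        (\<forall>u \<in> U \<inter> H. \<forall>v. \<phi>' u v \<bullet> \<nu> (\<phi> u) = 0))"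

text \<open>
  The second fundamental form with respect to \<open>\<nu>\<close> in the coordinates given by \<open>\<phi>\<close>, i.e. its value
  at the point \<open>\<phi> u\<close> on the pair of tangent vectors \<open>\<phi>' u v\<close>, \<open>\<phi>' u w\<close>.
\<close>

definition second_fundamental_form ::
  "(real^3 \<Rightarrow> real^3) \<Rightarrow> (real^2 \<Rightarrow> real^3) \<Rightarrow> (real^2 \<Rightarrow> (real^2) \<Rightarrow>\<^sub>L (real^2) \<Rightarrow>\<^sub>L (real^3))
     \<Rightarrow> real^2 \<Rightarrow> real^2 \<Rightarrow> real^2 \<Rightarrow> real" where
  "second_fundamental_form \<nu> \<phi> \<phi>'' u v w = \<phi>'' u v w \<bullet> \<nu> (\<phi> u)"

text \<open>Positivity is understood for a suitable choice of the unit normal field.\<close>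

definition positive_second_fundamental_form :: "(real^3) set \<Rightarrow> bool" where
  "positive_second_fundamental_form S \<longleftrightarrow>
     (\<exists>\<nu>. unit_normal_field S \<nu> \<and>
        (\<forall>U H \<phi> \<phi>' \<phi>''. local_parametrization S U H \<phi> \<phi>' \<phi>'' \<longrightarrow>
           (\<forall>u \<in> U \<inter> H. \<forall>v. v \<noteq> 0 \<longrightarrow> second_fundamental_form \<nu> \<phi> \<phi>'' u v v > 0)))"


section \<open>Surface measure and Fourier extension\<close>

text \<open>
  The surface measure of \<open>S\<close>, as a Borel measure on the ambient space: two-dimensional Hausdorff
  measure restricted to \<open>S\<close>.  The factor \<open>pi / 4\<close>, the area of a disc of diameter \<open>1\<close>, makes
  two-dimensional Hausdorff measure agree with Lebesgue measure on planes and hence with the area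
  element on surfaces.
\<close>

definition surface_measure :: "(real^3) set \<Rightarrow> (real^3) measure" where
  "surface_measure S =
     measure_of UNIV (sets borel) (\<lambda>A. ennreal (pi / 4) * hausdorff_measure 2 (A \<inter> S))"

text \<open>
  Hausdorff measure is a metric outer measure, hence countably additive on Borel sets.  This is
  what makes \<^const>\<open>surface_measure\<close> take the values it is defined by.
\<close>

lemma diam_cost_empty [simp]: "diam_cost s {} = 0"
  by (simp add: diam_cost_def)

lemma hausdorff_content_le:
  assumes "\<And>n. bounded (C n)" "\<And>n. diameter (C n) \<le> \<delta>" "A \<subseteq> (\<Union>n. C n)"
  shows "hausdorff_content s \<delta> A \<le> (\<Sum>n. diam_cost s (C n))"
  unfolding hausdorff_content_def using assms by (intro INF_lower) auto

lemma hausdorff_content_mono: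
  assumes "A \<subseteq> B" "\<epsilon> \<le> \<delta>"
  shows "hausdorff_content s \<delta> A \<le> hausdorff_content s \<epsilon> B"
  unfolding hausdorff_content_def using assms
  by (intro INF_superset_mono) (auto intro: order_trans)

lemma hausdorff_content_le_measure:
  "\<delta> > 0 \<Longrightarrow> hausdorff_content s \<delta> A \<le> hausdorff_measure s A"
  unfolding hausdorff_measure_def by (intro SUP_upper) auto

lemma hausdorff_measure_mono: "A \<subseteq> B \<Longrightarrow> hausdorff_measure s A \<le> hausdorff_measure s B"
  unfolding hausdorff_measure_def by (intro SUP_mono') (auto intro: hausdorff_content_mono)

lemma hausdorff_measure_empty [simp]: "hausdorff_measure s {} = 0"
proof -
  have "hausdorff_content s \<delta> ({}::'a set) \<le> 0" if "\<delta> > 0" for \<delta>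
    using hausdorff_content_le[of "\<lambda>_. {}::'a set" \<delta> "{}" s] that by simp
  then have "hausdorff_measure s ({}::'a set) \<le> 0"
    unfolding hausdorff_measure_def by (intro SUP_least) auto
  then show ?thesis by simp
qed

lemma hausdorff_content_close:
  assumes "hausdorff_content s \<delta> A < e"
  obtains C :: "nat \<Rightarrow> 'a::metric_space set"
  where "\<And>n. bounded (C n)" "\<And>n. diameter (C n) \<le> \<delta>" "A \<subseteq> (\<Union>n. C n)" "(\<Sum>n. diam_cost s (C n)) < e"
  using assms unfolding hausdorff_content_def INF_less_iff by blast

lemma hausdorff_content_subadditive:
  fixes A :: "nat \<Rightarrow> 'a::metric_space set"
  shows "hausdorff_content s \<delta> (\<Union>i. A i) \<le> (\<Sum>i. hausdorff_content s \<delta> (A i))"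
proof (rule ennreal_le_epsilon)
  let ?O = "hausdorff_content s \<delta>"
  fix e :: real assume e: "0 < e" and fin: "(\<Sum>n. ?O (A n)) < top"
  have "\<forall>n. \<exists>C. (\<forall>i. bounded (C i)) \<and> (\<forall>i. diameter (C i) \<le> \<delta>) \<and> A n \<subseteq> (\<Union>i. C i)
      \<and> (\<Sum>i. diam_cost s (C i)) \<le> ?O (A n) + e * (1/2)^Suc n"
  proof
    fix n
    have "?O (A n) < ?O (A n) + e * (1/2)^Suc n"
      using e fin by (auto simp add: less_top dest!: ennreal_suminf_lessD)
    from hausdorff_content_close[OF this]
    show "\<exists>C. (\<forall>i. bounded (C i)) \<and> (\<forall>i. diameter (C i) \<le> \<delta>) \<and> A n \<subseteq> (\<Union>i. C i)
      \<and> (\<Sum>i. diam_cost s (C i)) \<le> ?O (A n) + e * (1/2)^Suc n"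
      by (metis less_imp_le)
  qed
  then obtain B where B: "\<And>n i. bounded (B n i)" "\<And>n i. diameter (B n i) \<le> \<delta>"
      "\<And>n. A n \<subseteq> (\<Union>i. B n i)"
      "\<And>n. (\<Sum>i. diam_cost s (B n i)) \<le> ?O (A n) + e * (1/2)^Suc n"
    by metis
  define C where "C = case_prod B o prod_decode"
  have A_C: "(\<Union>i. A i) \<subseteq> (\<Union>i. C i)"
    using B(3) by (auto simp add: C_def subset_eq) (metis prod.case prod_encode_inverse)
  have "?O (\<Union>i. A i) \<le> (\<Sum>i. diam_cost s (C i))"
    using A_C B(1,2) by (intro hausdorff_content_le) (auto simp: C_def split: prod.split)
  also have "\<dots> = (\<Sum>n. \<Sum>i. diam_cost s (B n i))"
    using suminf_ennreal_2dimen[where f = "\<lambda>(n, i). diam_cost s (B n i)"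
        and g = "\<lambda>n. \<Sum>i. diam_cost s (B n i)"]
    by (simp add: C_def comp_def split_def)
  also have "\<dots> \<le> (\<Sum>n. ?O (A n) + e * (1/2) ^ Suc n)"
    by (intro suminf_le B(4)) auto
  also have "... = (\<Sum>n. ?O (A n)) + (\<Sum>n. ennreal e * ennreal ((1/2) ^ Suc n))"
    using \<open>0 < e\<close> by (subst suminf_add[symmetric])
                     (auto simp del: ennreal_suminf_cmult simp add: ennreal_mult[symmetric])
  also have "\<dots> = (\<Sum>n. ?O (A n)) + e"
    unfolding ennreal_suminf_cmult
    by (subst suminf_ennreal_eq[OF zero_le_power power_half_series]) auto
  finally show "?O (\<Union>i. A i) \<le> (\<Sum>n. ?O (A n)) + e" .
qed

lemma hausdorff_measure_subadditive:
  "hausdorff_measure s (\<Union>i::nat. A i) \<le> (\<Sum>i. hausdorff_measure s (A i))"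
  unfolding hausdorff_measure_def[of s "\<Union>i. A i"]
proof (intro SUP_least)
  fix \<delta> :: real assume "\<delta> \<in> {0<..}"
  then have "(\<Sum>i. hausdorff_content s \<delta> (A i)) \<le> (\<Sum>i. hausdorff_measure s (A i))"
    by (intro suminf_le hausdorff_content_le_measure) auto
  with hausdorff_content_subadditive[of s \<delta> A]
  show "hausdorff_content s \<delta> (\<Union>i. A i) \<le> (\<Sum>i. hausdorff_measure s (A i))"
    by (rule order_trans)
qed

lemma hausdorff_measure_Un_le:
  "hausdorff_measure s (A \<union> B) \<le> hausdorff_measure s A + hausdorff_measure s B"
proof -
  define X where "X i = (if i = 0 then A else if i = 1 then B else {})" for i :: nat
  have "(\<Union>i. X i) = A \<union> B"
    by (auto simp: X_def split: if_splits)
  moreover have "(\<Sum>i. hausdorff_measure s (X i)) = (\<Sum>i\<in>{0,1}. hausdorff_measure s (X i))"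
    by (intro suminf_finite) (auto simp: X_def)
  ultimately show ?thesis
    using hausdorff_measure_subadditive[of s X] by (simp add: X_def)
qed

lemma hausdorff_content_separated:
  assumes sep: "\<And>x y. x \<in> A \<Longrightarrow> y \<in> B \<Longrightarrow> \<delta> < dist x y"
  shows "hausdorff_content s \<delta> A + hausdorff_content s \<delta> B \<le> hausdorff_content s \<delta> (A \<union> B)"
  unfolding hausdorff_content_def[of s \<delta> "A \<union> B"]
proof (intro INF_greatest)
  fix C :: "nat \<Rightarrow> 'a set"
  assume "C \<in> {C. (\<forall>n. bounded (C n) \<and> diameter (C n) \<le> \<delta>) \<and> A \<union> B \<subseteq> (\<Union>n. C n)}"
  then have C: "\<And>n. bounded (C n)" "\<And>n. diameter (C n) \<le> \<delta>" "A \<union> B \<subseteq> (\<Union>n. C n)" by auto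
  define P where "P X n = (if C n \<inter> X = {} then {} else C n)" for X n
  have d: "0 \<le> \<delta>" using C(1,2)[of 0] diameter_ge_0 order_trans by blast
  have P: "bounded (P X n)" "diameter (P X n) \<le> \<delta>" for X n using C d by (auto simp: P_def)
  have *: "hausdorff_content s \<delta> X \<le> (\<Sum>n. diam_cost s (P X n))" if X: "X \<subseteq> A \<union> B" for X
  proof (intro hausdorff_content_le P)
    show "X \<subseteq> (\<Union>n. P X n)"
    proof
      fix x assume x: "x \<in> X"
      then obtain n where "x \<in> C n" using X C(3) by blast
      with x show "x \<in> (\<Union>n. P X n)" unfolding P_def by (intro UN_I[of n]) auto
    qed
  qed
  have disj: "C n \<inter> A = {} \<or> C n \<inter> B = {}" for n
  proof (rule ccontr)
    assume "\<not> ?thesis"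
    then obtain x y where "x \<in> C n" "x \<in> A" "y \<in> C n" "y \<in> B" by auto
    with sep[of x y] diameter_bounded_bound[OF C(1), of x n y] C(2)[of n] show False by auto
  qed
  have le: "diam_cost s (P A n) + diam_cost s (P B n) \<le> diam_cost s (C n)" for n
    using disj[of n] by (auto simp: P_def)
  have "hausdorff_content s \<delta> A + hausdorff_content s \<delta> B
      \<le> (\<Sum>n. diam_cost s (P A n)) + (\<Sum>n. diam_cost s (P B n))"
    by (intro add_mono *) auto
  also have "\<dots> = (\<Sum>n. diam_cost s (P A n) + diam_cost s (P B n))"
    by (intro suminf_add) auto
  also have "\<dots> \<le> (\<Sum>n. diam_cost s (C n))"
    by (intro suminf_le le) auto
  finally show "hausdorff_content s \<delta> A + hausdorff_content s \<delta> B \<le> (\<Sum>n. diam_cost s (C n))" .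
qed

lemma hausdorff_measure_separated:
  assumes d: "d > 0" and sep: "\<And>x y. x \<in> A \<Longrightarrow> y \<in> B \<Longrightarrow> d \<le> dist x y"
  shows "hausdorff_measure s A + hausdorff_measure s B \<le> hausdorff_measure s (A \<union> B)"
proof -
  have *: "hausdorff_content s \<delta>\<^sub>1 A + hausdorff_content s \<delta>\<^sub>2 B \<le> hausdorff_measure s (A \<union> B)"
    if "\<delta>\<^sub>1 > 0" "\<delta>\<^sub>2 > 0" for \<delta>\<^sub>1 \<delta>\<^sub>2
  proof -
    define \<delta> where "\<delta> = min (d / 2) (min \<delta>\<^sub>1 \<delta>\<^sub>2)"
    have \<delta>: "\<delta> > 0" "\<delta> < d" "\<delta> \<le> \<delta>\<^sub>1" "\<delta> \<le> \<delta>\<^sub>2" using d that by (auto simp: \<delta>_def)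
    have "hausdorff_content s \<delta>\<^sub>1 A + hausdorff_content s \<delta>\<^sub>2 B
        \<le> hausdorff_content s \<delta> A + hausdorff_content s \<delta> B"
      using \<delta> by (intro add_mono hausdorff_content_mono) auto
    also have "\<dots> \<le> hausdorff_content s \<delta> (A \<union> B)"
      using \<delta> sep by (intro hausdorff_content_separated) (meson less_le_trans)
    also have "\<dots> \<le> hausdorff_measure s (A \<union> B)"
      using \<delta> by (intro hausdorff_content_le_measure)
    finally show ?thesis .
  qed
  have "(SUP \<delta>\<in>{0<..}. hausdorff_content s \<delta> A) + b
      = (SUP \<delta>\<in>{0<..}. hausdorff_content s \<delta> A + b)" for b
    by (rule ennreal_SUP_add_left[symmetric]) auto
  moreover have "a + (SUP \<delta>\<in>{0<..}. hausdorff_content s \<delta> B)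
      = (SUP \<delta>\<in>{0<..}. a + hausdorff_content s \<delta> B)" for a
    by (rule ennreal_SUP_add_right) auto
  ultimately show ?thesis
    unfolding hausdorff_measure_def[of s A] hausdorff_measure_def[of s B]
    using * by (auto intro!: SUP_least)
qed

lemma hausdorff_measure_caratheodory:
  fixes F :: "'a::metric_space set"
  assumes F: "closed F"
  shows "hausdorff_measure s (A \<inter> F) + hausdorff_measure s (A - F) \<le> hausdorff_measure s A"
proof (cases "F = {} \<or> hausdorff_measure s A = top")
  case True
  then show ?thesis by auto
next
  case False
  let ?H = "hausdorff_measure s"
  define G where "G n = {x \<in> A. 1 / real (n + 1) \<le> infdist x F}" for n
  define R where "R n = {x \<in> A. 1 / real (n + 2) \<le> infdist x F \<and> infdist x F < 1 / real (n + 1)}" for n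
  have shell: "(\<Sum>k<m. ?H (R (2 * k + c))) \<le> ?H (\<Union>k<m. R (2 * k + c))" for c m
  proof (induction m)
    case (Suc m)
    define d where "d = 1 / real (2 * m + c) - 1 / real (2 * m + c + 1)"
    have "?H (\<Union>k<m. R (2 * k + c)) + ?H (R (2 * m + c))
        \<le> ?H ((\<Union>k<m. R (2 * k + c)) \<union> R (2 * m + c))"
    proof (cases "m = 0")
      case False
      show ?thesis
      proof (rule hausdorff_measure_separated)
        have "1 / real (2 * m + c + 1) < 1 / real (2 * m + c)"
          using False by (intro divide_strict_left_mono) auto
        then show "d > 0" by (simp add: d_def)
        fix x y assume "x \<in> (\<Union>k<m. R (2 * k + c))" and y: "y \<in> R (2 * m + c)"
        then obtain k where k: "k < m" and x: "x \<in> R (2 * k + c)" by auto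
        have "1 / real (2 * m + c) \<le> 1 / real (2 * k + c + 2)"
          using k by (intro divide_left_mono mult_pos_pos) linarith+
        also have "\<dots> \<le> infdist x F" using x by (simp add: R_def)
        also have "\<dots> \<le> infdist y F + dist x y" by (rule infdist_triangle)
        also have "infdist y F \<le> 1 / real (2 * m + c + 1)" using y by (simp add: R_def)
        finally show "d \<le> dist x y" by (simp add: d_def)
      qed
    qed simp
    also have "(\<Union>k<m. R (2 * k + c)) \<union> R (2 * m + c) = (\<Union>k<Suc m. R (2 * k + c))"
      by (auto simp: lessThan_Suc)
    finally show ?case using order_trans[OF add_right_mono[OF Suc]] by simp
  qed simp
  have "(\<Sum>k<m. ?H (R (2 * k + c))) \<le> ?H A" for c m
    by (rule order_trans[OF shell]) (auto intro!: hausdorff_measure_mono simp: R_def)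
  then have bound: "(\<Sum>k<2 * m. ?H (R k)) \<le> ?H A + ?H A" for m
  proof -
    have "(\<Sum>k<2 * m. ?H (R k)) = (\<Sum>k<m. ?H (R (2 * k + 0))) + (\<Sum>k<m. ?H (R (2 * k + 1)))"
      by (induction m) (auto simp: ac_simps)
    then show ?thesis
      using \<open>\<And>m c. (\<Sum>k<m. ?H (R (2 * k + c))) \<le> ?H A\<close> by (metis add_mono)
  qed
  have "(\<Sum>k. ?H (R k)) \<le> ?H A + ?H A"
  proof (rule suminf_le_const[OF summableI])
    fix m
    have "(\<Sum>k<m. ?H (R k)) \<le> (\<Sum>k<2 * m. ?H (R k))" by (intro sum_mono2) auto
    with bound[of m] show "(\<Sum>k<m. ?H (R k)) \<le> ?H A + ?H A" by (rule order_trans[rotated])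
  qed
  then have fin: "(\<Sum>k. ?H (R k)) < top"
    using False by (auto simp: less_top[symmetric] top_unique)
  have split: "?H (A \<inter> F) + ?H (A - F) \<le> ?H A + (\<Sum>k. ?H (R (k + n)))" for n
  proof -
    have "A - F \<subseteq> G n \<union> (\<Union>k. R (k + n))"
    proof
      fix x assume x: "x \<in> A - F"
      then have pos: "infdist x F > 0"
        using F False by (metis DiffD2 in_closed_iff_infdist_zero infdist_nonneg less_eq_real_def)
      then obtain m where m: "1 / real (m + 1) \<le> infdist x F"
        by (metis less_imp_le nat_approx_posE Suc_eq_plus1 of_nat_Suc)
      define l where "l = (LEAST m. 1 / real (m + 1) \<le> infdist x F)"
      have l: "1 / real (l + 1) \<le> infdist x F" unfolding l_def by (rule LeastI, rule m)
      have l': "infdist x F < 1 / real (j + 1)" if "j < l" for j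
        using not_less_Least[OF that[unfolded l_def]] by simp
      show "x \<in> G n \<union> (\<Union>k. R (k + n))"
      proof (cases "l \<le> n")
        case True
        then have "1 / real (n + 1) \<le> 1 / real (l + 1)" by (intro divide_left_mono) auto
        then show ?thesis using x l by (auto simp: G_def)
      next
        case False
        then obtain k where "l = Suc (k + n)" by (metis add.commute less_imp_Suc_add not_le)
        then have "x \<in> R (k + n)" using x l l'[of "k + n"] by (auto simp: R_def add_ac)
        then show ?thesis by auto
      qed
    qed
    then have "?H (A - F) \<le> ?H (G n) + ?H (\<Union>k. R (k + n))"
      by (rule order_trans[OF hausdorff_measure_mono hausdorff_measure_Un_le])
    also have "\<dots> \<le> ?H (G n) + (\<Sum>k. ?H (R (k + n)))"
      by (intro add_left_mono hausdorff_measure_subadditive)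
    finally have "?H (A \<inter> F) + ?H (A - F) \<le> (?H (A \<inter> F) + ?H (G n)) + (\<Sum>k. ?H (R (k + n)))"
      by (metis add.assoc add_left_mono)
    also have "?H (A \<inter> F) + ?H (G n) \<le> ?H (A \<inter> F \<union> G n)"
    proof (rule hausdorff_measure_separated)
      fix x y assume "x \<in> A \<inter> F" "y \<in> G n"
      then have "1 / real (n + 1) \<le> infdist y F" "infdist y F \<le> dist y x"
        by (auto simp: G_def intro: infdist_le)
      then show "1 / real (n + 1) \<le> dist x y" by (simp add: dist_commute)
    qed simp
    also have "?H (A \<inter> F \<union> G n) \<le> ?H A" by (intro hausdorff_measure_mono) (auto simp: G_def)
    finally show ?thesis by (simp add: add_right_mono)
  qed
  have Hfin: "?H (R k) < top" for k
    using fin by (rule ennreal_suminf_lessD)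
  define h where "h k = enn2real (?H (R k))" for k
  have h: "?H (R k) = ennreal (h k)" "h k \<ge> 0" for k
    using Hfin[of k] by (auto simp: h_def)
  have summ: "summable h"
    using fin h by (intro summable_suminf_not_top) (auto simp: less_top)
  have tail: "(\<Sum>k. ?H (R (k + n))) = ennreal (\<Sum>k. h (k + n))" for n
    unfolding h(1) using summ h(2) by (intro suminf_ennreal2) (auto simp: summable_iff_shift)
  have "(\<lambda>n. ennreal (\<Sum>k. h (k + n))) \<longlonglongrightarrow> ennreal 0"
    by (intro tendsto_ennrealI suminf_exist_split2 summ)
  then have "(\<lambda>n. ?H A + (\<Sum>k. ?H (R (k + n)))) \<longlonglongrightarrow> ?H A + 0"
    unfolding tail by (intro tendsto_add) auto
  with split show ?thesis
    by (intro LIMSEQ_le_const[of _ _ "?H (A \<inter> F) + ?H (A - F)"]) auto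
qed

lemma borel_lambda_system_hausdorff:
  fixes B :: "'a::metric_space set"
  assumes "B \<in> sets borel"
  shows "B \<in> lambda_system UNIV (Pow UNIV) (hausdorff_measure s)"
proof -
  interpret P: sigma_algebra "UNIV :: 'a set" "Pow UNIV" by (rule sigma_algebra_Pow)
  let ?L = "lambda_system UNIV (Pow UNIV) (hausdorff_measure s :: 'a set \<Rightarrow> _)"
  have "outer_measure_space (Pow UNIV) (hausdorff_measure s :: 'a set \<Rightarrow> _)"
    by (auto simp: outer_measure_space_def positive_def increasing_def countably_subadditive_def
        intro: hausdorff_measure_mono hausdorff_measure_subadditive)
  then have "measure_space UNIV ?L (hausdorff_measure s)"
    by (rule P.caratheodory_lemma)
  then interpret L: sigma_algebra UNIV ?L by (simp add: measure_space_def)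
  have "F \<in> ?L" if "closed F" for F
    unfolding P.lambda_system_eq
  proof (safe intro!: antisym)
    fix X
    show "hausdorff_measure s (X \<inter> F) + hausdorff_measure s (X - F) \<le> hausdorff_measure s X"
      using that by (rule hausdorff_measure_caratheodory)
    show "hausdorff_measure s X \<le> hausdorff_measure s (X \<inter> F) + hausdorff_measure s (X - F)"
      using hausdorff_measure_Un_le[of s "X \<inter> F" "X - F"] by (simp add: Int_Diff_Un)
  qed auto
  then have "sigma_sets UNIV (Collect closed) \<subseteq> ?L"
    by (intro L.sigma_sets_subset) auto
  then show "B \<in> ?L" using assms by (auto simp: borel_eq_closed)
qed

lemma space_surface_measure [simp]: "space (surface_measure S) = UNIV"
  by (simp add: surface_measure_def space_measure_of_conv)

lemma sets_surface_measure [simp, measurable_cong]: "sets (surface_measure S) = sets borel"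
  unfolding surface_measure_def
  by (metis sets.sets_measure_of_eq space_borel)

lemma emeasure_surface_measure:
  assumes B: "B \<in> sets borel"
  shows "emeasure (surface_measure S) B = ennreal (pi / 4) * hausdorff_measure 2 (B \<inter> S)"
proof -
  let ?H = "hausdorff_measure 2 :: (real^3) set \<Rightarrow> _"
  interpret P: sigma_algebra "UNIV :: (real^3) set" "Pow UNIV" by (rule sigma_algebra_Pow)
  let ?\<mu> = "\<lambda>A. ennreal (pi / 4) * ?H (A \<inter> S)"
  have ca: "countably_additive (sets borel) ?\<mu>"
    unfolding countably_additive_def
  proof (intro allI impI)
    fix A :: "nat \<Rightarrow> (real^3) set"
    assume A: "range A \<subseteq> sets borel" "disjoint_family A"
    have "hausdorff_measure 2 ((\<Union>i. A i) \<inter> S) = (\<Sum>i. ?H (A i \<inter> S))"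
    proof (rule antisym)
      show "?H ((\<Union>i. A i) \<inter> S) \<le> (\<Sum>i. ?H (A i \<inter> S))"
        using hausdorff_measure_subadditive[of 2 "\<lambda>i. A i \<inter> S"] by (simp add: Int_commute)
      show "(\<Sum>i. ?H (A i \<inter> S)) \<le> ?H ((\<Union>i. A i) \<inter> S)"
      proof (rule suminf_le_const[OF summableI])
        fix n
        have "(\<Sum>i = 0..<n. ?H (S \<inter> A i)) = ?H (S \<inter> (\<Union>i\<in>{0..<n}. A i))"
          using A borel_lambda_system_hausdorff
          by (intro P.lambda_system_strong_sum) (auto simp: positive_def)
        also have "\<dots> \<le> ?H ((\<Union>i. A i) \<inter> S)" by (intro hausdorff_measure_mono) auto
        finally show "(\<Sum>i<n. ?H (A i \<inter> S)) \<le> ?H ((\<Union>i. A i) \<inter> S)"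
          by (simp add: Int_commute atLeast0LessThan)
      qed
    qed
    then show "(\<Sum>i. ?\<mu> (A i)) = ?\<mu> (\<Union> (range A))" by simp
  qed
  have sa: "sigma_algebra UNIV (sets (borel :: (real^3) measure))"
    using sets.sigma_algebra_axioms[of "borel :: (real^3) measure"] by simp
  show ?thesis
    unfolding surface_measure_def
    by (rule emeasure_measure_of_sigma[OF sa _ ca B]) (simp add: positive_def)
qed

definition Lp_space :: "real \<Rightarrow> 'a measure \<Rightarrow> ('a \<Rightarrow> complex) set" where
  "Lp_space p M = {f \<in> borel_measurable M. integrable M (\<lambda>x. norm (f x) powr p)}"

definition Lp_norm :: "real \<Rightarrow> 'a measure \<Rightarrow> ('a \<Rightarrow> complex) \<Rightarrow> real" where
  "Lp_norm p M f = (LINT x|M. norm (f x) powr p) powr (1 / p)"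

definition fourier_extension :: "(real^3) set \<Rightarrow> (real^3 \<Rightarrow> complex) \<Rightarrow> real^3 \<Rightarrow> complex" where
  "fourier_extension S f x = (LINT \<xi>|surface_measure S. exp (\<i> * complex_of_real (x \<bullet> \<xi>)) * f \<xi>)"


section \<open>Kakeya sets\<close>

definition Kakeya_set :: "(real^3) set \<Rightarrow> bool" where
  "Kakeya_set K \<longleftrightarrow> compact K \<and> (\<forall>e. norm e = 1 \<longrightarrow> (\<exists>a. closed_segment a (a + e) \<subseteq> K))"

definition kakeya_exponent :: "real \<Rightarrow> real" where
  "kakeya_exponent p = (6 - p) / (p - 2)"

end

theory Submission
  imports Defs
begin

text \<open>
  Apply the extension inequality on the unit sphere.  At scale \<open>\<delta>\<close>, split a corner of the sphere
  into caps of width \<open>\<delta>\<close>.  The extension of the indicator of a cap around \<open>e\<close>, modulated so as to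
  translate it, has size at least about \<open>\<delta>\<^sup>2\<close> on a tube of length about \<open>1/\<delta>\<^sup>2\<close> and
  width \<open>1/\<delta>\<close> in direction \<open>e\<close> that can be placed anywhere.  Averaging that inequality
  over random signs bounds the \<open>L\<close>-norm of order \<open>p/2\<close> of the number of tubes through a point.

  If a Kakeya set had vanishing \<open>s\<close>-dimensional measure, cover it by countably many sets and sort
  them by dyadic diameter.  Pigeonholing along each segment and then among directions gives
  one scale \<open>\<delta>\<close> at which, up to a factor \<open>\<delta>\<close> to a small power, about \<open>1/\<delta>\<^sup>2\<close> separated directions
  have a segment almost full of sets of diameter about \<open>\<delta>\<close>.  Place the tubes along these segments,
  dilated.  The few sets of that scale fill only a small volume, in which all the tubes have to
  overlap; the bound on the overlap is violated when \<open>s < (6 - p)/(p - 2)\<close>.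
\<close>

section \<open>The unit sphere as a positively curved surface\<close>

text \<open>An orthogonal map taking the third axis to \<open>p\<close> carries the standard basis
  to a frame whose last vector is \<open>p\<close>.\<close>

lemma orthonormal_completion:
  fixes p :: "real^3"
  assumes "norm p = 1"
  obtains a b where "a \<bullet> a = 1" "b \<bullet> b = 1" "p \<bullet> p = 1" "a \<bullet> b = 0" "a \<bullet> p = 0" "b \<bullet> p = 0"
    "\<And>x. x = (x \<bullet> a) *\<^sub>R a + (x \<bullet> b) *\<^sub>R b + (x \<bullet> p) *\<^sub>R p"
proof -
  obtain f :: "real^3 \<Rightarrow> real^3" where f: "orthogonal_transformation f" "f (axis 3 1) = p"
    using orthogonal_transformation_exists_1[of "axis 3 1" p] assms by (auto simp: norm_axis_1)
  then have lin: "linear f" and inner: "\<And>v w. f v \<bullet> f w = v \<bullet> w"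
    by (auto simp: orthogonal_transformation_def)
  have surj: "surj f" using f(1) by (rule orthogonal_transformation_surj)
  show thesis
  proof (rule that[of "f (axis 1 1)" "f (axis 2 1)"])
    fix x
    obtain y where x: "x = f y" using surj by auto
    have y: "y = (y $ 1) *\<^sub>R axis 1 1 + (y $ 2) *\<^sub>R axis 2 1 + (y $ 3) *\<^sub>R axis 3 1"
      by (simp add: vec_eq_iff forall_3 axis_def)
    have "f y = (y $ 1) *\<^sub>R f (axis 1 1) + (y $ 2) *\<^sub>R f (axis 2 1) + (y $ 3) *\<^sub>R p"
      by (subst y) (simp add: linear_add[OF lin] linear_scale[OF lin] f(2))
    moreover have "x \<bullet> f (axis 1 1) = y $ 1" "x \<bullet> f (axis 2 1) = y $ 2" "x \<bullet> p = y $ 3"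
      unfolding x inner f(2)[symmetric] by (simp_all add: inner_axis)
    ultimately show "x = (x \<bullet> f (axis 1 1)) *\<^sub>R f (axis 1 1) + (x \<bullet> f (axis 2 1)) *\<^sub>R f (axis 2 1) + (x \<bullet> p) *\<^sub>R p"
      using x by simp
  qed (simp_all add: inner f(2)[symmetric], simp_all add: inner_axis_axis)
qed

text \<open>The open hemisphere centred at \<open>p\<close> is the graph of
  \<open>sqrt (1 - u \<bullet> u)\<close> over the unit disc in the tangent plane at
  \<open>p\<close>. Orthogonal projection onto that plane inverts this chart, and letting
  \<open>p\<close> vary covers the sphere without boundary charts.\<close>

lemma sphere_local_parametrization:
  fixes p :: "real^3"
  assumes p: "norm p = 1"
  shows "\<exists>\<phi> \<phi>' \<phi>''. local_parametrization (sphere 0 1) (ball 0 1) UNIV \<phi> \<phi>' \<phi>'' \<and> p \<in> \<phi> ` (ball 0 1 \<inter> UNIV)"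
proof -
  obtain a b where ab: "a \<bullet> a = 1" "b \<bullet> b = 1" "p \<bullet> p = 1" "a \<bullet> b = 0" "a \<bullet> p = 0" "b \<bullet> p = 0"
    and expand: "\<And>x. x = (x \<bullet> a) *\<^sub>R a + (x \<bullet> b) *\<^sub>R b + (x \<bullet> p) *\<^sub>R p"
    using orthonormal_completion[OF p] by blast
  have ab': "b \<bullet> a = 0" "p \<bullet> a = 0" "p \<bullet> b = 0" using ab by (simp_all add: inner_commute)
  define T :: "real^2 \<Rightarrow> real^3" where "T u = (u $ 1) *\<^sub>R a + (u $ 2) *\<^sub>R b" for u
  have T: "bounded_linear T"
    unfolding T_def by (intro bounded_linear_add bounded_linear_compose[OF bounded_linear_scaleR_left]
        bounded_linear_vec_nth)
  define h :: "real^2 \<Rightarrow> real" where "h u = sqrt (1 - u \<bullet> u)" for u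
  \<comment> \<open>\<open>L u v\<close> is \<open>(u \<bullet> v) *\<^sub>R p\<close>. Hence the
    derivative of the height term \<open>h u *\<^sub>R p\<close> is \<open>- L u\<close> divided by
    \<open>h u\<close>.\<close>
  define L :: "real^2 \<Rightarrow> (real^2) \<Rightarrow>\<^sub>L (real^3)"
    where "L u = blinfun_scaleR_left p o\<^sub>L blinfun_inner_left u" for u
  have L: "bounded_linear L"
    unfolding L_def by (intro bounded_linear_intros)
  define \<phi> where "\<phi> u = T u + h u *\<^sub>R p" for u
  define \<phi>' where "\<phi>' u = Blinfun T - inverse (h u) *\<^sub>R L u" for u
  \<comment> \<open>This is the product rule for \<open>inverse (h u) *\<^sub>R L u\<close>: the
    derivative of \<open>inverse (h u)\<close> in direction \<open>v\<close> is
    \<open>(u \<bullet> v)\<close> times the cube of \<open>inverse (h u)\<close>, and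
    \<open>L\<close> is linear.\<close>
  define \<phi>'' where "\<phi>'' u = - ((inverse (h u)^3) *\<^sub>R (blinfun_scaleR_left (L u) o\<^sub>L blinfun_inner_left u))
      - inverse (h u) *\<^sub>R Blinfun L" for u
  have hpos: "h u > 0" if "u \<in> ball 0 1" for u
  proof -
    have "u \<bullet> u < 1" using that by (simp add: dot_square_norm abs_square_less_1)
    then show ?thesis by (simp add: h_def)
  qed
  have h': "(h has_derivative (\<lambda>v. - ((u \<bullet> v) * inverse (h u)))) (at u)" if "u \<in> ball 0 1" for u
    using hpos[OF that] unfolding h_def
    by (auto intro!: derivative_eq_intros simp: field_simps inner_commute)
  have C2: "C2_on (ball 0 1) \<phi> \<phi>' \<phi>''"
    unfolding C2_on_def
  proof (intro conjI ballI)
    fix u :: "real^2" assume u: "u \<in> ball 0 1"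
    have Td: "(T has_derivative T) (at u)" using T by (rule bounded_linear_imp_has_derivative)
    have ih: "((\<lambda>u. inverse (h u)) has_derivative (\<lambda>v. inverse (h u)^3 * (u \<bullet> v))) (at u)"
      using Deriv.has_derivative_inverse[OF _ h'[OF u]] hpos[OF u] by (simp add: power3_eq_cube mult_ac)
    have Ld: "(L has_derivative L) (at u)" using L by (rule bounded_linear_imp_has_derivative)
    show "(\<phi> has_derivative blinfun_apply (\<phi>' u)) (at u)"
      unfolding \<phi>_def
      by (rule derivative_eq_intros Td h'[OF u] refl)+
        (auto simp: \<phi>'_def fun_eq_iff blinfun.bilinear_simps L_def bounded_linear_Blinfun_apply[OF T] inner_commute)
    show "(\<phi>' has_derivative blinfun_apply (\<phi>'' u)) (at u)"
      unfolding \<phi>'_def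
      by (rule derivative_eq_intros Ld ih refl)+
        (simp add: \<phi>''_def fun_eq_iff blinfun.bilinear_simps bounded_linear_Blinfun_apply[OF L] inner_commute)
  next
    have "continuous_on (ball 0 1) h" unfolding h_def by (intro continuous_intros)
    moreover have "continuous_on (ball 0 1) L" using L by (rule linear_continuous_on)
    moreover have "\<forall>x\<in>ball 0 1. h x \<noteq> 0" using hpos by fastforce
    ultimately show "continuous_on (ball 0 1) \<phi>''"
      unfolding \<phi>''_def by (intro continuous_intros bounded_linear.continuous_on[OF bounded_linear_blinfun_scaleR_left] bounded_linear.continuous_on[OF bounded_linear_blinfun_inner_left]) auto
  qed
  have inj: "inj (blinfun_apply (\<phi>' u))" for u
  proof (rule injI)
    fix v w assume eq: "\<phi>' u v = \<phi>' u w"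
    have *: "\<phi>' u z \<bullet> a = z $ 1" "\<phi>' u z \<bullet> b = z $ 2" for z
      using ab ab' by (simp_all add: \<phi>'_def blinfun.bilinear_simps L_def
          bounded_linear_Blinfun_apply[OF T] T_def inner_simps)
    show "v = w" using *[of v] *[of w] eq by (simp add: vec_eq_iff forall_2)
  qed
  define \<psi> :: "real^3 \<Rightarrow> real^2" where "\<psi> x = vector [x \<bullet> a, x \<bullet> b]" for x
  have \<psi>\<phi>: "\<psi> (\<phi> u) = u" for u
    using ab ab' by (simp add: \<psi>_def \<phi>_def T_def vec_eq_iff forall_2 inner_simps)
  have uu: "u \<bullet> u = (u $ 1)^2 + (u $ 2)^2" for u :: "real^2"
    by (simp add: inner_vec_def sum_2 power2_eq_square)
  \<comment> \<open>Identifying the image as the part of the sphere in an open half-space makes it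
    relatively open.\<close>
  have img: "\<phi> ` ball 0 1 = sphere 0 1 \<inter> {x. 0 < x \<bullet> p}"
  proof (intro equalityI subsetI)
    fix x assume "x \<in> \<phi> ` ball 0 1"
    then obtain u where u: "u \<in> ball 0 1" and x: "x = \<phi> u" by blast
    have "x \<bullet> x = u \<bullet> u + (h u)^2"
      using ab ab' unfolding x by (simp add: \<phi>_def T_def inner_simps uu power2_eq_square)
    also have "\<dots> = 1" using hpos[OF u] by (simp add: h_def)
    finally have "norm x = 1" by (simp add: norm_eq_1)
    moreover have "x \<bullet> p = h u" using ab ab' unfolding x by (simp add: \<phi>_def T_def inner_simps)
    ultimately show "x \<in> sphere 0 1 \<inter> {x. 0 < x \<bullet> p}" using hpos[OF u] by simp
  next
    fix x :: "real^3" assume "x \<in> sphere 0 1 \<inter> {x. 0 < x \<bullet> p}"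
    then have x: "x \<bullet> x = 1" "0 < x \<bullet> p" by (auto simp: norm_eq_1)
    have "x \<bullet> x = (x \<bullet> a)^2 + (x \<bullet> b)^2 + (x \<bullet> p)^2"
      using ab ab' by (subst (2) expand[of x]) (simp add: inner_simps power2_eq_square)
    then have 1: "\<psi> x \<bullet> \<psi> x = 1 - (x \<bullet> p)^2" using x by (simp add: uu \<psi>_def)
    then have "norm (\<psi> x) < 1" using x by (simp add: norm_lt_square)
    moreover have "\<phi> (\<psi> x) = x"
      unfolding \<phi>_def T_def h_def 1 using x by (simp add: \<psi>_def expand[symmetric])
    ultimately show "x \<in> \<phi> ` ball 0 1" by (metis imageI mem_ball_0)
  qed
  have c\<phi>: "continuous_on (ball 0 1) \<phi>"
    using C2 unfolding C2_on_def
    by (intro continuous_at_imp_continuous_on ballI has_derivative_continuous) blast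
  have "continuous_on X (\<lambda>x. (x \<bullet> a) *\<^sub>R axis 1 1 + (x \<bullet> b) *\<^sub>R axis 2 1 :: real^2)" for X
    by (intro continuous_intros)
  moreover have "\<psi> = (\<lambda>x. (x \<bullet> a) *\<^sub>R axis 1 1 + (x \<bullet> b) *\<^sub>R axis 2 1)"
    by (simp add: \<psi>_def fun_eq_iff vec_eq_iff forall_2 axis_def)
  ultimately have c\<psi>: "continuous_on X \<psi>" for X by simp
  have hom: "homeomorphism (ball 0 1) (\<phi> ` ball 0 1) \<phi> \<psi>"
    by (rule homeomorphismI) (auto simp: c\<phi> c\<psi> \<psi>\<phi>)
  have "open {x. 0 < x \<bullet> p}" by (intro open_Collect_less continuous_intros)
  then have op: "openin (top_of_set (sphere 0 1)) (\<phi> ` ball 0 1)"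
    unfolding img by (simp add: openin_open_Int)
  have "\<phi> 0 = p" by (simp add: \<phi>_def T_def h_def)
  then have "p \<in> \<phi> ` ball 0 1" by (metis centre_in_ball imageI zero_less_one)
  with C2 inj hom op show ?thesis
    unfolding local_parametrization_def by (intro exI[of _ \<phi>] exI[of _ \<phi>'] exI[of _ \<phi>'']) auto
qed

lemma C2_surface_sphere: "C2_surface (sphere 0 1)"
  unfolding C2_surface_def
proof
  fix p :: "real^3" assume "p \<in> sphere 0 1"
  then have "norm p = 1" by simp
  from sphere_local_parametrization[OF this]
  show "\<exists>U H \<phi> \<phi>' \<phi>''. local_parametrization (sphere 0 1) U H \<phi> \<phi>' \<phi>'' \<and> p \<in> \<phi> ` (U \<inter> H)"
    by (intro exI[of _ "ball 0 1"] exI[of _ UNIV])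
qed

text \<open>
  Parametrizations are only constrained on \<open>U \<inter> H\<close>, so identities can be differentiated only at
  interior points of \<open>H\<close>; boundary points are reached by continuity.
\<close>

lemma local_parametrization_eq_0:
  fixes g :: "real^2 \<Rightarrow> real"
  assumes "open U" "H = UNIV \<or> H = half_plane" "continuous_on U g"
    and "\<And>u. u \<in> U \<inter> interior H \<Longrightarrow> g u = 0" and u: "u \<in> U \<inter> H"
  shows "g u = 0"
proof -
  have half: "{u. 0 < u $ 1} \<subseteq> interior half_plane"
    by (intro interior_maximal) (auto simp: half_plane_def intro!: open_Collect_less continuous_intros)
  \<comment> \<open>Moving \<open>u\<close> slightly in the first coordinate enters the interior of
    the half-plane, even from its edge.\<close>
  define x where "x n = u + (1 / real (Suc n)) *\<^sub>R axis 1 1" for n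
  have x: "x \<longlonglongrightarrow> u"
    unfolding x_def
    using tendsto_add[OF tendsto_const tendsto_scaleR[OF LIMSEQ_inverse_real_of_nat tendsto_const], of u "axis 1 1"]
    by (simp add: inverse_eq_divide)
  have "x n \<in> interior H" for n
  proof (cases "H = UNIV")
    case False
    then have "0 \<le> u $ 1" "H = half_plane" using assms(2) u by (auto simp: half_plane_def)
    then show ?thesis using half by (auto simp: x_def add_nonneg_pos)
  qed simp
  moreover have "\<forall>\<^sub>F n in sequentially. x n \<in> U"
    using x assms(1) u by (auto simp: tendsto_def)
  ultimately have "\<forall>\<^sub>F n in sequentially. g (x n) = 0"
    by (auto elim!: eventually_mono intro!: assms(4))
  then have "(\<lambda>n. g (x n)) \<longlonglongrightarrow> 0" by (rule tendsto_eventually)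
  moreover have "isCont g u" using assms(1,3) u by (auto simp: continuous_on_eq_continuous_at)
  then have "(\<lambda>n. g (x n)) \<longlonglongrightarrow> g u" using x by (rule isCont_tendsto_compose)
  ultimately show ?thesis using LIMSEQ_unique by blast
qed

text \<open>Differentiating \<open>\<phi> \<bullet> \<phi> = 1\<close> once shows that the position
  vector is normal; differentiating the result again relates the second derivative to the metric.
  Arbitrary charts have to be treated, because normality and positivity quantify over all of
  them.\<close>

lemma sphere_parametrization_derivatives:
  assumes "local_parametrization (sphere 0 1) U H \<phi> \<phi>' \<phi>''" and u: "u \<in> U \<inter> H"
  shows "\<phi>' u v \<bullet> \<phi> u = 0" "\<phi>'' u v v \<bullet> \<phi> u = - (\<phi>' u v \<bullet> \<phi>' u v)"
proof -
  have U: "open U" and H: "H = UNIV \<or> H = half_plane"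
    and d1: "\<And>u. u \<in> U \<Longrightarrow> (\<phi> has_derivative blinfun_apply (\<phi>' u)) (at u)"
    and d2: "\<And>u. u \<in> U \<Longrightarrow> (\<phi>' has_derivative blinfun_apply (\<phi>'' u)) (at u)"
    and c2: "continuous_on U \<phi>''"
    and op: "openin (top_of_set (sphere 0 1)) (\<phi> ` (U \<inter> H))"
    using assms(1) unfolding local_parametrization_def C2_on_def by simp_all
  have "\<phi> ` (U \<inter> H) \<subseteq> sphere 0 1" by (rule openin_imp_subset[OF op])
  then have "\<phi> w \<in> sphere 0 1" if "w \<in> U \<inter> interior H" for w
    using that interior_subset[of H] by blast
  then have sph: "\<phi> w \<bullet> \<phi> w = 1" if "w \<in> U \<inter> interior H" for w
    using that by (simp flip: norm_eq_1)
  have c0: "continuous_on U \<phi>"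
    by (intro continuous_at_imp_continuous_on ballI has_derivative_continuous[OF d1])
  have c1: "continuous_on U \<phi>'"
    by (intro continuous_at_imp_continuous_on ballI has_derivative_continuous[OF d2])
  have I: "open (U \<inter> interior H)" using U by auto
  have *: "\<phi>' w z \<bullet> \<phi> w = 0" if w: "w \<in> U \<inter> interior H" for w z
  proof -
    have "((\<lambda>x. \<phi> x \<bullet> \<phi> x) has_derivative (\<lambda>z. \<phi> w \<bullet> \<phi>' w z + \<phi>' w z \<bullet> \<phi> w)) (at w)"
      using d1[of w] w by (auto intro!: derivative_eq_intros)
    moreover have "((\<lambda>x. \<phi> x \<bullet> \<phi> x) has_derivative (\<lambda>z. 0)) (at w)"
      by (rule has_derivative_transform_within_open[OF has_derivative_const I w])
        (simp add: sph)
    ultimately have "(\<lambda>z. \<phi> w \<bullet> \<phi>' w z + \<phi>' w z \<bullet> \<phi> w) = (\<lambda>z. 0)"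
      by (rule has_derivative_unique)
    then have "\<phi> w \<bullet> \<phi>' w z + \<phi>' w z \<bullet> \<phi> w = 0" by (rule fun_cong)
    then show ?thesis by (simp add: inner_commute)
  qed
  show "\<phi>' u v \<bullet> \<phi> u = 0"
    by (rule local_parametrization_eq_0[OF U H _ * u]) (intro continuous_intros c0 c1)
  have **: "\<phi>'' w v v \<bullet> \<phi> w + \<phi>' w v \<bullet> \<phi>' w v = 0" if w: "w \<in> U \<inter> interior H" for w
  proof -
    have "((\<lambda>x. \<phi>' x v \<bullet> \<phi> x) has_derivative (\<lambda>z. \<phi>' w v \<bullet> \<phi>' w z + \<phi>'' w z v \<bullet> \<phi> w)) (at w)"
      using d1[of w] d2[of w] w
      by (auto intro!: derivative_eq_intros simp: blinfun.bilinear_simps)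
    moreover have "((\<lambda>x. \<phi>' x v \<bullet> \<phi> x) has_derivative (\<lambda>z. 0)) (at w)"
      by (rule has_derivative_transform_within_open[OF has_derivative_const I w]) (simp add: *)
    ultimately have "(\<lambda>z. \<phi>' w v \<bullet> \<phi>' w z + \<phi>'' w z v \<bullet> \<phi> w) = (\<lambda>z. 0)"
      by (rule has_derivative_unique)
    then have "\<phi>' w v \<bullet> \<phi>' w v + \<phi>'' w v v \<bullet> \<phi> w = 0" by (rule fun_cong)
    then show ?thesis by simp
  qed
  have "\<phi>'' u v v \<bullet> \<phi> u + \<phi>' u v \<bullet> \<phi>' u v = 0"
    by (rule local_parametrization_eq_0[OF U H _ ** u]) (intro continuous_intros c0 c1 c2)
  then show "\<phi>'' u v v \<bullet> \<phi> u = - (\<phi>' u v \<bullet> \<phi>' u v)" by simp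
qed

text \<open>With the inward normal, the second fundamental form of the unit sphere is its metric,
  which is positive because charts are immersions.\<close>

lemma positive_second_fundamental_form_sphere: "positive_second_fundamental_form (sphere 0 1)"
  unfolding positive_second_fundamental_form_def
proof (intro exI[of _ uminus] conjI allI impI ballI)
  show "unit_normal_field (sphere 0 1) uminus"
    unfolding unit_normal_field_def
    by (auto intro!: continuous_intros sphere_parametrization_derivatives(1))
next
  fix U H \<phi> \<phi>' \<phi>'' u and v :: "real^2"
  assume loc: "local_parametrization (sphere 0 1) U H \<phi> \<phi>' \<phi>''" and u: "u \<in> U \<inter> H" and v: "v \<noteq> 0"
  have "inj (blinfun_apply (\<phi>' u))" using loc u by (auto simp: local_parametrization_def)
  then have "\<phi>' u v \<noteq> 0" using v by (metis injD blinfun.zero_right)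
  then show "second_fundamental_form uminus \<phi> \<phi>'' u v v > 0"
    by (simp add: second_fundamental_form_def sphere_parametrization_derivatives(2)[OF loc u])
qed

section \<open>Surface measure of caps\<close>

text \<open>The intervals are half-open so that they tile the half-line without overlap. Pairs of
  cells index the caps of the sphere, and single cells subdivide the parameter interval of a
  segment.\<close>

definition cell :: "real \<Rightarrow> nat \<Rightarrow> real set" where
  "cell d i = {real i * d..<real (Suc i) * d}"

lemma cell_borel [measurable]: "cell d i \<in> sets borel"
  by (simp add: cell_def)

lemma cell_unique:
  assumes "0 < d" "x \<in> cell d i" "x \<in> cell d j"
  shows "i = j"
proof -
  have "real i * d < real (Suc j) * d" "real j * d < real (Suc i) * d" using assms unfolding cell_def atLeastLessThan_iff by linarith+
  then have "real i < real (Suc j)" "real j < real (Suc i)"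
    using assms(1) by (simp_all only: mult_less_cancel_right_pos)
  then show ?thesis by linarith
qed

lemma cell_subset:
  assumes "0 < d" "real (Suc i) * d \<le> 1/2"
  shows "cell d i \<subseteq> {0..<1/2}"
proof
  fix x assume x: "x \<in> cell d i"
  have "0 \<le> real i * d" using assms by simp
  then show "x \<in> {0..<1/2}" using x assms unfolding cell_def atLeastLessThan_iff by linarith
qed

lemma cell_cover:
  assumes "0 < d" "0 \<le> x" "x < real m * d"
  shows "\<exists>i<m. x \<in> cell d i"
proof -
  define i where "i = nat \<lfloor>x / d\<rfloor>"
  have i: "real i \<le> x / d" "x / d < real i + 1"
    using assms by (auto simp: i_def)
  then have "x \<in> cell d i" using assms by (simp add: cell_def field_simps)
  moreover have "x / d < real m" using assms by (simp add: field_simps)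
  then have "i < m" using i by linarith
  ultimately show ?thesis by blast
qed

definition patch :: "real set \<Rightarrow> real set \<Rightarrow> (real^3) set" where
  "patch X Y = {\<xi> \<in> sphere 0 1. 0 < \<xi> $ 3 \<and> \<xi> $ 1 \<in> X \<and> \<xi> $ 2 \<in> Y}"

lemma patch_borel [measurable]: "X \<in> sets borel \<Longrightarrow> Y \<in> sets borel \<Longrightarrow> patch X Y \<in> sets borel"
proof -
  assume [measurable]: "X \<in> sets borel" "Y \<in> sets borel"
  have [measurable]: "(\<lambda>\<xi>::real^3. \<xi> $ i) \<in> borel_measurable borel" for i
    by (intro borel_measurable_continuous_onI continuous_intros)
  have "patch X Y = {\<xi> \<in> space borel. norm \<xi> = 1 \<and> 0 < \<xi> $ 3 \<and> \<xi> $ 1 \<in> X \<and> \<xi> $ 2 \<in> Y}"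
    by (auto simp: patch_def)
  then show ?thesis by simp
qed

lemma norm_vec3_sq: "(norm (x::real^3))^2 = (x $ 1)^2 + (x $ 2)^2 + (x $ 3)^2"
  unfolding power2_norm_eq_inner by (simp add: inner_vec_def sum_3 power2_eq_square)

text \<open>Over the square of side \<open>1/2\<close> both third coordinates have square at least
  \<open>1/2\<close>, so their sum \<open>?s\<close> has square at least 2. On the sphere,
  \<open>?t * ?s\<close> is a difference of squares governed by the first two coordinates, hence at
  most \<open>2 * d\<close> in size. Thus \<open>?t^2\<close> is at most \<open>2 * d^2\<close>, and
  the three coordinates together contribute at most \<open>4 * d^2\<close>.\<close>

lemma patch_dist_le:
  assumes X: "X \<subseteq> {0..1/2}" "Y \<subseteq> {0..1/2}"
    and d: "\<And>x x'. x \<in> X \<Longrightarrow> x' \<in> X \<Longrightarrow> \<bar>x - x'\<bar> \<le> d" "\<And>y y'. y \<in> Y \<Longrightarrow> y' \<in> Y \<Longrightarrow> \<bar>y - y'\<bar> \<le> d"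
    and mem: "\<xi> \<in> patch X Y" "\<eta> \<in> patch X Y"
  shows "norm (\<xi> - \<eta>) \<le> 2 * d"
proof -
  have z: "1/2 \<le> (\<zeta> $ 3)^2 \<and> 0 < \<zeta> $ 3 \<and> (\<zeta> $ 1)^2 + (\<zeta> $ 2)^2 + (\<zeta> $ 3)^2 = 1 \<and>
      0 \<le> \<zeta> $ 1 \<and> \<zeta> $ 1 \<le> 1/2 \<and> 0 \<le> \<zeta> $ 2 \<and> \<zeta> $ 2 \<le> 1/2" if "\<zeta> \<in> patch X Y" for \<zeta>
  proof -
    have 1: "(norm \<zeta>)^2 = 1" and r: "0 \<le> \<zeta> $ 1" "\<zeta> $ 1 \<le> 1/2" "0 \<le> \<zeta> $ 2" "\<zeta> $ 2 \<le> 1/2" "0 < \<zeta> $ 3"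
      using that X by (auto simp: patch_def)
    have "(\<zeta> $ 1)^2 \<le> (1/2)^2" "(\<zeta> $ 2)^2 \<le> (1/2)^2" using r by (intro power_mono; simp)+
    then show ?thesis using 1 r unfolding norm_vec3_sq by (simp add: power2_eq_square)
  qed
  note zx = z[OF mem(1)] and zy = z[OF mem(2)]
  have d1: "\<bar>\<xi> $ 1 - \<eta> $ 1\<bar> \<le> d" "\<bar>\<xi> $ 2 - \<eta> $ 2\<bar> \<le> d"
    using mem d by (auto simp: patch_def)
  then have d0: "0 \<le> d" by linarith
  let ?s = "\<xi> $ 3 + \<eta> $ 3" and ?t = "\<xi> $ 3 - \<eta> $ 3"
  have "(\<xi> $ 3 * \<eta> $ 3)^2 \<ge> (1/2)^2"
    unfolding power_mult_distrib using zx zy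
    by (metis mult_mono power2_eq_square zero_le_power2 divide_nonneg_pos zero_le_one zero_less_numeral order_trans)
  then have "\<xi> $ 3 * \<eta> $ 3 \<ge> 1/2" using zx zy by (smt (verit) mult_pos_pos power2_le_imp_le)
  then have s: "2 \<le> ?s^2" using zx zy by (simp add: power2_sum)
  have "?t * ?s = (\<eta> $ 1 - \<xi> $ 1) * (\<eta> $ 1 + \<xi> $ 1) + (\<eta> $ 2 - \<xi> $ 2) * (\<eta> $ 2 + \<xi> $ 2)"
    using zx zy by (simp add: algebra_simps power2_eq_square)
  also have "\<bar>\<dots>\<bar> \<le> \<bar>(\<eta> $ 1 - \<xi> $ 1) * (\<eta> $ 1 + \<xi> $ 1)\<bar> + \<bar>(\<eta> $ 2 - \<xi> $ 2) * (\<eta> $ 2 + \<xi> $ 2)\<bar>"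
    by (rule abs_triangle_ineq)
  also have "\<dots> \<le> d * 1 + d * 1"
    unfolding abs_mult using d1 zx zy by (intro add_mono mult_mono) auto
  finally have ts: "\<bar>?t * ?s\<bar> \<le> 2 * d" by simp
  have "?t^2 * 2 \<le> ?t^2 * ?s^2" using s by (intro mult_left_mono) auto
  also have "\<dots> = \<bar>?t * ?s\<bar>^2" by (simp add: power_mult_distrib)
  also have "\<dots> \<le> (2 * d)^2" using ts by (intro power_mono) auto
  finally have "?t^2 \<le> 2 * d^2" by (simp add: power_mult_distrib)
  moreover have "(\<xi> $ 1 - \<eta> $ 1)^2 \<le> d^2" "(\<xi> $ 2 - \<eta> $ 2)^2 \<le> d^2"
    using d1 by (metis abs_ge_zero power2_abs power_mono)+
  ultimately have "(norm (\<xi> - \<eta>))^2 \<le> (2 * d)^2"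
    unfolding norm_vec3_sq by (simp add: power_mult_distrib)
  then show ?thesis using d0 by (auto intro: power2_le_imp_le)
qed

lemma patch_point:
  assumes "x \<in> X" "y \<in> Y" "x \<in> {0..1/2}" "y \<in> {0..1/2}"
  obtains \<xi> where "\<xi> \<in> patch X Y" "\<xi> $ 1 = x" "\<xi> $ 2 = y"
proof
  define \<xi> :: "real^3" where "\<xi> = vector [x, y, sqrt (1 - x^2 - y^2)]"
  have "x^2 \<le> (1/2)^2" "y^2 \<le> (1/2)^2" using assms by (intro power_mono; simp)+
  then have pos: "0 < 1 - x^2 - y^2" by (simp add: power2_eq_square)
  then have "(norm \<xi>)^2 = 1" unfolding norm_vec3_sq by (simp add: \<xi>_def)
  then have "norm \<xi> = 1" by (simp add: power2_eq_1_iff) (smt (verit) norm_ge_zero)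
  then show "\<xi> \<in> patch X Y" using assms pos by (simp add: patch_def \<xi>_def)
  show "\<xi> $ 1 = x" "\<xi> $ 2 = y" by (simp_all add: \<xi>_def)
qed

text \<open>Projection to the first two coordinates does not increase distances. A covering set of
  diameter \<open>r\<close> therefore projects into a square of area \<open>4 * r^2\<close>, and
  these squares must cover an area of \<open>d^2\<close>.\<close>

lemma hausdorff_measure_patch_ge:
  assumes "0 \<le> x" "x + d \<le> 1/2" "0 \<le> y" "y + d \<le> 1/2" "0 < d"
  shows "ennreal (d^2 / 4) \<le> hausdorff_measure 2 (patch {x..<x+d} {y..<y+d})"
proof -
  let ?P = "patch {x..<x+d} {y..<y+d}"
  have "ennreal (d^2 / 4) \<le> hausdorff_content 2 1 ?P"
    unfolding hausdorff_content_def
  proof (intro INF_greatest)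
    fix C :: "nat \<Rightarrow> (real^3) set"
    assume "C \<in> {C. (\<forall>n. bounded (C n) \<and> diameter (C n) \<le> 1) \<and> ?P \<subseteq> (\<Union>n. C n)}"
    then have bd: "\<And>n. bounded (C n)" and cov: "?P \<subseteq> (\<Union>n. C n)" by auto
    define c where "c n = (SOME z. z \<in> C n)" for n
    define r where "r n = diameter (C n)" for n
    have r0: "0 \<le> r n" for n by (simp add: r_def diameter_ge_0 bd)
    \<comment> \<open>The square is centred at the projection of a chosen point of
      \<open>C n\<close>, so its half-side is the full diameter. It is empty together with
      \<open>C n\<close>, to match the zero cost of the empty set.\<close>
    define D where "D n = (if C n = {} then {} else {c n $ 1 - r n..c n $ 1 + r n} \<times> {c n $ 2 - r n..c n $ 2 + r n})" for n
    have Dm [measurable]: "D n \<in> sets borel" for n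
      by (auto simp: D_def intro!: borel_closed closed_Times)
    have D: "emeasure lborel (D n) \<le> ennreal 4 * diam_cost 2 (C n)" for n
    proof (cases "C n = {}")
      case False
      have "emeasure lborel (D n) = emeasure lborel {c n $ 1 - r n..c n $ 1 + r n} * emeasure lborel {c n $ 2 - r n..c n $ 2 + r n}"
        using False unfolding D_def lborel_prod[symmetric]
        by (simp add: lborel.emeasure_pair_measure_Times)
      also have "\<dots> = ennreal 4 * diam_cost 2 (C n)"
        using False r0[of n] by (simp add: diam_cost_def ennreal_mult[symmetric] r_def[symmetric] power2_eq_square flip: ennreal_numeral)
      finally show ?thesis by simp
    qed (simp add: D_def)
    have sub: "{x..<x+d} \<times> {y..<y+d} \<subseteq> (\<Union>n. D n)"
    proof clarify
      fix s t assume st: "s \<in> {x..<x+d}" "t \<in> {y..<y+d}"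
      obtain \<xi> where \<xi>: "\<xi> \<in> ?P" "\<xi> $ 1 = s" "\<xi> $ 2 = t"
        using patch_point[of s _ t, OF st] st assms by auto
      then obtain n where n: "\<xi> \<in> C n" using cov by auto
      then have "c n \<in> C n" unfolding c_def by (rule someI)
      then have "norm (\<xi> - c n) \<le> r n"
        using diameter_bounded_bound[OF bd n] by (simp add: r_def dist_norm)
      then have "\<bar>(\<xi> - c n) $ 1\<bar> \<le> r n" "\<bar>(\<xi> - c n) $ 2\<bar> \<le> r n"
        using component_le_norm_cart order_trans by blast+
      then show "(s, t) \<in> (\<Union>n. D n)" using n \<xi> by (auto simp: D_def abs_le_iff intro!: exI[of _ n])
    qed
    have "ennreal (d^2) = emeasure lborel ({x..<x+d} \<times> {y..<y+d})"
      unfolding lborel_prod[symmetric]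
      using assms by (simp add: lborel.emeasure_pair_measure_Times ennreal_mult[symmetric] power2_eq_square)
    also have "\<dots> \<le> emeasure lborel (\<Union>n. D n)"
      using sub by (intro emeasure_mono) auto
    also have "\<dots> \<le> (\<Sum>n. emeasure lborel (D n))"
      by (intro emeasure_subadditive_countably) auto
    also have "\<dots> \<le> (\<Sum>n. ennreal 4 * diam_cost 2 (C n))" by (intro suminf_le D) auto
    also have "\<dots> = 4 * (\<Sum>n. diam_cost 2 (C n))" by simp
    finally have "ennreal (1/4) * ennreal (d^2) \<le> ennreal (1/4) * (4 * (\<Sum>n. diam_cost 2 (C n)))"
      by (rule mult_left_mono) simp
    moreover have "ennreal (1/4) * (4 * z) = z" for z
      by (simp add: mult.assoc[symmetric] ennreal_mult[symmetric] flip: ennreal_numeral)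
    ultimately show "ennreal (d^2 / 4) \<le> (\<Sum>n. diam_cost 2 (C n))"
      by (simp add: ennreal_mult[symmetric])
  qed
  also have "\<dots> \<le> hausdorff_measure 2 ?P" by (rule hausdorff_content_le_measure) simp
  finally show ?thesis .
qed

text \<open>Cutting the base square into \<open>n * n\<close> squares of side
  \<open>1 / (2 * n)\<close> gives patches of diameter at most \<open>1 / n\<close>, whose total
  cost is at most 1 at every scale.\<close>

lemma hausdorff_measure_patch_le: "hausdorff_measure 2 (patch {0..<1/2} {0..<1/2}) \<le> 1"
  unfolding hausdorff_measure_def
proof (intro SUP_least)
  fix \<delta> :: real assume "\<delta> \<in> {0<..}"
  then obtain m where m: "1 / real (Suc m) < \<delta>" using nat_approx_posE by auto
  define n where "n = Suc m"
  define d where "d = 1 / (2 * real n)"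
  have n: "n > 0" "1 / real n < \<delta>" using m by (auto simp: n_def)
  then have d: "0 < d" "real n * d = 1/2" by (auto simp: d_def)
  define X where "X i = {0..<1/2} \<inter> cell d i" for i
  \<comment> \<open>The index \<open>i * n + j\<close> encodes the pair \<open>(i, j)\<close>; the
    remaining sets are empty and cost nothing.\<close>
  define C where "C k = (if k < n * n then patch (X (k div n)) (X (k mod n)) else {})" for k
  have close: "norm (\<xi> - \<eta>) \<le> 1 / n" if "\<xi> \<in> C k" "\<eta> \<in> C k" for \<xi> \<eta> k
  proof -
    have X: "\<bar>x - x'\<bar> \<le> d" if "x \<in> X i" "x' \<in> X i" for x x' i
      using that unfolding X_def cell_def by (auto simp: abs_le_iff algebra_simps)
    have "norm (\<xi> - \<eta>) \<le> 2 * d"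
      by (rule patch_dist_le[of "X (k div n)" "X (k mod n)"])
        (use that X in \<open>auto simp: C_def X_def split: if_splits\<close>)
    then show ?thesis by (simp add: d_def)
  qed
  have diam: "diameter (C k) \<le> 1 / n" for k
    using close n by (intro diameter_le) auto
  have bnd: "bounded (C k)" for k
    by (rule bounded_subset[of "sphere 0 1"]) (auto simp: C_def patch_def)
  have index: "\<exists>i<n. x \<in> X i" if "x \<in> {0..<1/2}" for x
    using cell_cover[of d x n] that d by (auto simp: X_def)
  have "patch {0..<1/2} {0..<1/2} \<subseteq> (\<Union>k. C k)"
  proof
    fix \<xi> assume \<xi>: "\<xi> \<in> patch {0..<1/2} {0..<1/2}"
    then obtain i j where ij: "i < n" "j < n" "\<xi> $ 1 \<in> X i" "\<xi> $ 2 \<in> X j"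
      using index unfolding patch_def by blast
    have "i * n + j < n * n"
    proof -
      have "i * n + j < Suc i * n" using ij by simp
      also have "\<dots> \<le> n * n" using ij by (intro mult_right_mono) auto
      finally show ?thesis .
    qed
    then have "\<xi> \<in> C (i * n + j)" using \<xi> ij by (simp add: C_def patch_def)
    then show "\<xi> \<in> (\<Union>k. C k)" by blast
  qed
  then have "hausdorff_content 2 \<delta> (patch {0..<1/2} {0..<1/2}) \<le> (\<Sum>k. diam_cost 2 (C k))"
    using bnd diam n order_trans[OF diam less_imp_le[OF n(2)]] by (intro hausdorff_content_le)
  also have "\<dots> = (\<Sum>k<n * n. diam_cost 2 (C k))"
    by (intro suminf_finite) (auto simp: C_def)
  also have "\<dots> \<le> (\<Sum>k<n * n. ennreal ((1 / n)^2))"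
  proof (intro sum_mono)
    fix k
    have "diameter (C k) ^ 2 \<le> (1 / n)^2" using diam bnd by (intro power_mono diameter_ge_0)
    then show "diam_cost 2 (C k) \<le> ennreal ((1 / n)^2)"
      using diameter_ge_0[OF bnd] by (auto simp: diam_cost_def intro!: ennreal_leI)
  qed
  also have "\<dots> = 1" using n by (simp add: ennreal_of_nat_eq_real_of_nat ennreal_mult[symmetric] power2_eq_square)
  finally show "hausdorff_content 2 \<delta> (patch {0..<1/2} {0..<1/2}) \<le> 1" .
qed

lemma surface_measure_patch_ge:
  assumes "0 \<le> x" "x + d \<le> 1/2" "0 \<le> y" "y + d \<le> 1/2" "0 < d"
  shows "ennreal (d^2 / 8) \<le> emeasure (surface_measure (sphere 0 1)) (patch {x..<x+d} {y..<y+d})"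
proof -
  have "ennreal (d^2 / 8) \<le> ennreal (pi / 4 * (d^2 / 4))"
    using pi_ge_two by (intro ennreal_leI) (simp add: mult_right_mono)
  also have "\<dots> = ennreal (pi / 4) * ennreal (d^2 / 4)" by (rule ennreal_mult) auto
  also have "\<dots> \<le> ennreal (pi / 4) * hausdorff_measure 2 (patch {x..<x+d} {y..<y+d})"
    by (intro mult_left_mono hausdorff_measure_patch_ge assms) simp
  also have "patch {x..<x+d} {y..<y+d} = patch {x..<x+d} {y..<y+d} \<inter> sphere 0 1" by (auto simp: patch_def)
  finally show ?thesis by (subst emeasure_surface_measure) auto
qed

lemma surface_measure_patch_le:
  "emeasure (surface_measure (sphere 0 1)) (patch {0..<1/2} {0..<1/2}) \<le> 1"
proof -
  have "patch {0..<1/2} {0..<1/2} \<inter> sphere 0 1 = patch {0..<1/2} {0..<1/2}" by (auto simp: patch_def)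
  then have "emeasure (surface_measure (sphere 0 1)) (patch {0..<1/2} {0..<1/2})
      = ennreal (pi / 4) * hausdorff_measure 2 (patch {0..<1/2} {0..<1/2})"
    by (subst emeasure_surface_measure) auto
  also have "\<dots> \<le> 1 * 1"
    using pi_less_4 by (intro mult_mono hausdorff_measure_patch_le) (auto simp: ennreal_le_1)
  finally show ?thesis by simp
qed

section \<open>The square function\<close>

text \<open>This is convexity of the power. If an endpoint is 0, it reduces to
  \<open>(1/2) powr q \<le> 1/2\<close>.\<close>

lemma powr_midpoint_le:
  fixes a b q :: real
  assumes "0 \<le> a" "0 \<le> b" "1 \<le> q"
  shows "((a + b) / 2) powr q \<le> (a powr q + b powr q) / 2"
proof (cases "a = 0 \<or> b = 0")
  case True
  have "(1/2) powr q \<le> (1/2) powr (1::real)" using assms(3) by (intro powr_mono') auto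
  then have "(c / 2) powr q \<le> c powr q / 2" if "0 \<le> c" for c :: real
    using that mult_left_mono[of "(1/2) powr q" "1/2" "c powr q"] powr_mult[of c "1/2" q] by simp
  then show ?thesis using True assms by auto
next
  case False
  then show ?thesis
    using convex_onD[OF powr_convex[OF assms(3)], of "1/2" a b] assms by (simp add: field_simps)
qed

lemma parallelogram_law_midpoint:
  fixes a b :: "'a::real_inner"
  shows "((norm (a + b))^2 + (norm (a - b))^2) / 2 = (norm a)^2 + (norm b)^2"
  by (simp add: power2_norm_eq_inner inner_simps inner_commute)

text \<open>
  This replaces Khintchine's inequality: signs are averaged one at a time, by the parallelogram law
  and the convexity of \<open>t \<mapsto> t powr q\<close>.
\<close>

lemma nn_integral_square_function_le:
  fixes g :: "'i \<Rightarrow> 'a \<Rightarrow> complex" and h :: "'a \<Rightarrow> complex"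
  assumes "finite J" and q: "1 \<le> q"
    and g: "\<And>j. j \<in> J \<Longrightarrow> g j \<in> borel_measurable M" and "h \<in> borel_measurable M"
    and "\<And>\<epsilon>. (\<And>j. \<epsilon> j = 1 \<or> \<epsilon> j = -1) \<Longrightarrow>
      (\<integral>\<^sup>+x. ennreal (((norm (h x + (\<Sum>j\<in>J. of_real (\<epsilon> j) * g j x)))^2) powr q) \<partial>M) \<le> B"
  shows "(\<integral>\<^sup>+x. ennreal (((norm (h x))^2 + (\<Sum>j\<in>J. (norm (g j x))^2)) powr q) \<partial>M) \<le> B"
  using assms(1) g assms(4,5)
proof (induction J arbitrary: h)
  case empty
  then show ?case using empty(3)[of "\<lambda>_. 1"] by simp
next
  case (insert k J)
  have [measurable]: "g j \<in> borel_measurable M" if "j \<in> insert k J" for j using insert.prems that by auto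
  have [measurable]: "h \<in> borel_measurable M" using insert.prems by auto
  define S where "S x = (\<Sum>j\<in>J. (norm (g j x))^2)" for x
  have S0: "0 \<le> S x" for x by (simp add: S_def sum_nonneg)
  have [measurable]: "S \<in> borel_measurable M" unfolding S_def by measurable
  \<comment> \<open>Once the sign of \<open>g k\<close> is fixed, that term is absorbed into
    \<open>h\<close>; this is why the induction lets \<open>h\<close> vary.\<close>
  have half: "(\<integral>\<^sup>+x. ennreal (((norm (h x + of_real s * g k x))^2 + S x) powr q) \<partial>M) \<le> B"
    if s: "s = 1 \<or> s = -1" for s :: real
    unfolding S_def
  proof (rule insert.IH)
    fix \<epsilon> :: "'i \<Rightarrow> real" assume \<epsilon>: "\<And>j. \<epsilon> j = 1 \<or> \<epsilon> j = -1"
    have "(\<Sum>j\<in>J. of_real ((\<epsilon>(k := s)) j) * g j x) = (\<Sum>j\<in>J. of_real (\<epsilon> j) * g j x)" for x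
      using insert.hyps by (intro sum.cong) auto
    then show "(\<integral>\<^sup>+x. ennreal (((norm (h x + of_real s * g k x + (\<Sum>j\<in>J. of_real (\<epsilon> j) * g j x)))^2) powr q) \<partial>M) \<le> B"
      using insert.prems(3)[of "\<epsilon>(k := s)"] \<epsilon> s insert.hyps by (simp add: add.assoc)
  qed auto
  have "(\<integral>\<^sup>+x. ennreal (((norm (h x))^2 + (\<Sum>j\<in>insert k J. (norm (g j x))^2)) powr q) \<partial>M)
      \<le> (\<integral>\<^sup>+x. (ennreal (1/2) * ennreal (((norm (h x + of_real 1 * g k x))^2 + S x) powr q)
          + ennreal (1/2) * ennreal (((norm (h x + of_real (-1) * g k x))^2 + S x) powr q)) \<partial>M)"
  proof (intro nn_integral_mono)
    fix x
    let ?a = "(norm (h x + of_real 1 * g k x))^2 + S x" and ?b = "(norm (h x + of_real (-1) * g k x))^2 + S x"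
    have "(norm (h x))^2 + (\<Sum>j\<in>insert k J. (norm (g j x))^2) = (?a + ?b) / 2"
      using insert.hyps parallelogram_law_midpoint[of "h x" "g k x"] by (simp add: S_def)
    then have "((norm (h x))^2 + (\<Sum>j\<in>insert k J. (norm (g j x))^2)) powr q \<le> (?a powr q + ?b powr q) / 2"
      using powr_midpoint_le[OF _ _ q, of ?a ?b] S0[of x] by (metis add_nonneg_nonneg zero_le_power2)
    then have "ennreal (((norm (h x))^2 + (\<Sum>j\<in>insert k J. (norm (g j x))^2)) powr q)
        \<le> ennreal (1/2 * (?a powr q) + 1/2 * (?b powr q))"
      by (intro ennreal_leI) simp
    also have "\<dots> = ennreal (1/2) * ennreal (?a powr q) + ennreal (1/2) * ennreal (?b powr q)"
      by (subst ennreal_plus) (simp_all only: ennreal_mult' powr_ge_zero zero_le_mult_iff, simp_all)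
    finally show "ennreal (((norm (h x))^2 + (\<Sum>j\<in>insert k J. (norm (g j x))^2)) powr q)
        \<le> ennreal (1/2) * ennreal (?a powr q) + ennreal (1/2) * ennreal (?b powr q)" .
  qed
  also have "\<dots> = ennreal (1/2) * (\<integral>\<^sup>+x. ennreal (((norm (h x + of_real 1 * g k x))^2 + S x) powr q) \<partial>M)
      + ennreal (1/2) * (\<integral>\<^sup>+x. ennreal (((norm (h x + of_real (-1) * g k x))^2 + S x) powr q) \<partial>M)"
    by (subst nn_integral_add, measurable) (simp add: nn_integral_cmult)
  also have "\<dots> \<le> ennreal (1/2) * B + ennreal (1/2) * B"
    by (intro add_mono mult_left_mono half) auto
  also have "\<dots> = B"
    unfolding distrib_right[symmetric] by (subst ennreal_plus[symmetric]) auto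
  finally show ?case .
qed

section \<open>Restriction and overlapping tubes\<close>

text \<open>The closed neighbourhood of radius \<open>W\<close> of a unit segment dilated by
  \<open>R\<close>. Keeping \<open>b\<close> and \<open>e\<close> undilated lets the segments of a
  Kakeya set be inserted directly.\<close>

definition tube :: "real \<Rightarrow> real \<Rightarrow> real^3 \<Rightarrow> real^3 \<Rightarrow> (real^3) set" where
  "tube R W b e = {x. \<exists>t\<in>{0..1}. norm (x - R *\<^sub>R (b + t *\<^sub>R e)) \<le> W}"

lemma tube_borel [measurable]: "tube R W b e \<in> sets borel"
proof -
  have "tube R W b e = (\<lambda>(t, z). R *\<^sub>R (b + t *\<^sub>R e) + z) ` ({0..1} \<times> cball 0 W)"
    by (force simp: tube_def image_def norm_minus_commute)
  also have "compact \<dots>"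
    by (intro compact_continuous_image compact_Times)
      (auto intro!: continuous_intros simp: split_def)
  finally show ?thesis by (intro borel_compact)
qed

abbreviation sphere_measure :: "(real^3) measure" where
  "sphere_measure \<equiv> surface_measure (sphere 0 1)"

abbreviation corner :: "(real^3) set" where
  "corner \<equiv> patch {0..<1/2} {0..<1/2}"

text \<open>The corner has surface measure at most 1, so functions dominated by its indicator have
  norm at most 1 for every positive exponent.\<close>

lemma bounded_by_corner:
  assumes f: "f \<in> borel_measurable borel" and le: "\<And>\<xi>. norm (f \<xi>) \<le> indicator corner \<xi>" and p: "0 < p"
  shows "integrable sphere_measure f" "f \<in> Lp_space p sphere_measure" "Lp_norm p sphere_measure f \<le> 1"
proof -
  have [measurable]: "f \<in> borel_measurable borel" by (rule f)
  have fin: "emeasure sphere_measure corner < \<infinity>"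
    using surface_measure_patch_le by (metis ennreal_one_less_top infinity_ennreal_def order_le_less_trans)
  then have ind: "integrable sphere_measure (indicator corner :: _ \<Rightarrow> real)" by simp
  show "integrable sphere_measure f"
    by (rule Bochner_Integration.integrable_bound[OF ind]) (use le in auto)
  have le': "norm (f \<xi>) powr p \<le> indicator corner \<xi>" for \<xi>
    using le[of \<xi>] p powr_mono2[of p "norm (f \<xi>)" 1] by (auto simp: indicator_def split: if_splits)
  have int: "integrable sphere_measure (\<lambda>\<xi>. norm (f \<xi>) powr p)"
    by (rule Bochner_Integration.integrable_bound[OF ind]) (use le' in auto)
  then show "f \<in> Lp_space p sphere_measure" by (simp add: Lp_space_def)
  have "(LINT \<xi>|sphere_measure. norm (f \<xi>) powr p) \<le> (LINT \<xi>|sphere_measure. indicator corner \<xi>)"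
    by (intro integral_mono int ind le')
  also have "\<dots> = measure sphere_measure corner" by simp
  also have "\<dots> \<le> 1" using surface_measure_patch_le
    by (simp add: measure_def enn2real_leI)
  finally show "Lp_norm p sphere_measure f \<le> 1"
    unfolding Lp_norm_def using p by (intro powr_le1) auto
qed

text \<open>After the phase at \<open>e\<close> is factored out, the remaining phase is at most
  \<open>1/2\<close> on the cap, so the integrand cannot cancel more than half of the mass
  \<open>m\<close>, which is at least \<open>d^2 / 8\<close>. The modulation by
  \<open>R *\<^sub>R b\<close> translates the tube.\<close>

lemma fourier_extension_cap_ge:
  assumes d: "0 < d" "real (Suc i) * d \<le> 1/2" "real (Suc l) * d \<le> 1/2"
    and e: "e \<in> patch (cell d i) (cell d l)"
    and x: "x \<in> tube (1 / (8 * d^2)) (1 / (8 * d)) b e"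
  shows "d^2 / 16 \<le> norm (fourier_extension (sphere 0 1)
    (\<lambda>\<xi>. indicator (patch (cell d i) (cell d l)) \<xi> * exp (- (\<i> * of_real (((1 / (8 * d^2)) *\<^sub>R b) \<bullet> \<xi>)))) x)"
proof -
  let ?P = "patch (cell d i) (cell d l)"
  define R where "R = 1 / (8 * d^2)"
  define y where "y = x - R *\<^sub>R b"
  obtain t where t: "0 \<le> t" "t \<le> 1" "norm (x - R *\<^sub>R (b + t *\<^sub>R e)) \<le> 1 / (8 * d)"
    using x by (auto simp: tube_def R_def)
  have sub: "cell d i \<subseteq> {0..<1/2}" "cell d l \<subseteq> {0..<1/2}"
    using d by (intro cell_subset; simp)+
  have P: "?P \<subseteq> corner" using sub by (auto simp: patch_def)
  have close: "norm (\<xi> - e) \<le> 2 * d" if "\<xi> \<in> ?P" for \<xi>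
  proof (rule patch_dist_le[OF _ _ _ _ that e])
    show "cell d i \<subseteq> {0..1/2}" "cell d l \<subseteq> {0..1/2}" using sub by fastforce+
  qed (auto simp: cell_def abs_le_iff algebra_simps)
  have phase: "\<bar>y \<bullet> (\<xi> - e)\<bar> \<le> 1/2" if \<xi>: "\<xi> \<in> ?P" for \<xi>
  proof -
    have n: "\<xi> \<bullet> \<xi> = 1" "e \<bullet> e = 1" using \<xi> e by (auto simp: patch_def norm_eq_1)
    \<comment> \<open>The sphere leaves its tangent plane only quadratically: points of the cap
      differ by about \<open>d^2\<close> in direction \<open>e\<close>. This is what allows a tube
      as long as \<open>1 / d^2\<close>.\<close>
    have "(norm (\<xi> - e))^2 = 2 - 2 * (e \<bullet> \<xi>)"
      by (simp add: power2_norm_eq_inner inner_simps n inner_commute[of \<xi> e])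
    moreover have "e \<bullet> (\<xi> - e) = e \<bullet> \<xi> - 1" by (simp add: inner_simps n)
    moreover have "e \<bullet> \<xi> \<le> 1"
      using Cauchy_Schwarz_ineq2[of e \<xi>] n by (simp add: norm_eq_sqrt_inner)
    ultimately have "\<bar>e \<bullet> (\<xi> - e)\<bar> = (norm (\<xi> - e))^2 / 2" by simp
    also have "\<dots> \<le> (2 * d)^2 / 2" using close[OF \<xi>] by (intro divide_right_mono power_mono) auto
    finally have 1: "\<bar>e \<bullet> (\<xi> - e)\<bar> \<le> 2 * d^2" by (simp add: power_mult_distrib)
    \<comment> \<open>The component along the tube and the offset across it each contribute at most
      \<open>1/4\<close> to the phase; the factors 8 in length and width are chosen for
      this.\<close>
    have "y \<bullet> (\<xi> - e) = (R * t) * (e \<bullet> (\<xi> - e)) + (x - R *\<^sub>R (b + t *\<^sub>R e)) \<bullet> (\<xi> - e)"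
      by (simp add: y_def inner_simps algebra_simps)
    also have "\<bar>\<dots>\<bar> \<le> \<bar>(R * t) * (e \<bullet> (\<xi> - e))\<bar> + \<bar>(x - R *\<^sub>R (b + t *\<^sub>R e)) \<bullet> (\<xi> - e)\<bar>"
      by (rule abs_triangle_ineq)
    also have "\<dots> \<le> (R * 1) * (2 * d^2) + norm (x - R *\<^sub>R (b + t *\<^sub>R e)) * norm (\<xi> - e)"
      unfolding abs_mult using 1 t d
      by (intro add_mono mult_mono Cauchy_Schwarz_ineq2) (auto simp: R_def)
    also have "\<dots> \<le> (R * 1) * (2 * d^2) + 1 / (8 * d) * (2 * d)"
      using t d close[OF \<xi>] by (intro add_left_mono mult_mono) auto
    also have "\<dots> = 1/2" using d by (simp add: R_def)
    finally show ?thesis .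
  qed
  have fin: "emeasure sphere_measure ?P < \<infinity>"
    using surface_measure_patch_le emeasure_mono[OF P, of sphere_measure]
    by (auto simp: le_less_trans)
  define m where "m = measure sphere_measure ?P"
  have "ennreal (d^2 / 8) \<le> emeasure sphere_measure ?P"
    using surface_measure_patch_ge[of "real i * d" d "real l * d"] d by (simp add: cell_def algebra_simps)
  then have m: "d^2 / 8 \<le> m"
    using fin by (simp add: m_def emeasure_eq_ennreal_measure)
  have ind: "integrable sphere_measure (indicator ?P :: _ \<Rightarrow> real)" using fin by simp
  \<comment> \<open>\<open>F\<close> is the deviation from the constant phase, bounded through
    \<open>2 * \<bar>sin (t / 2)\<bar> \<le> \<bar>t\<bar>\<close>.\<close>
  define F where "F \<xi> = indicator ?P \<xi> * (exp (\<i> * of_real (y \<bullet> (\<xi> - e))) - 1)" for \<xi>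
  have [measurable]: "(\<lambda>\<xi>. exp (\<i> * of_real (y \<bullet> (\<xi> - e)))) \<in> borel_measurable borel"
    by (intro borel_measurable_continuous_onI continuous_intros)
  have [measurable]: "F \<in> borel_measurable borel" unfolding F_def by measurable
  have Fle: "norm (F \<xi>) \<le> 1/2 * indicator ?P \<xi>" for \<xi>
  proof (cases "\<xi> \<in> ?P")
    case True
    have "norm (F \<xi>) = 2 * \<bar>sin (y \<bullet> (\<xi> - e) / 2)\<bar>" using True by (simp add: F_def dist_exp_i_1)
    also have "\<dots> \<le> 2 * \<bar>y \<bullet> (\<xi> - e) / 2\<bar>" by (intro mult_left_mono abs_sin_x_le_abs_x) auto
    also have "\<dots> \<le> 1/2" using phase[OF True] by simp
    finally show ?thesis using True by simp
  qed (simp add: F_def)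
  have Fint: "integrable sphere_measure F"
    by (rule Bochner_Integration.integrable_bound[OF integrable_mult_right[OF ind, of "1/2"]])
      (use Fle in auto)
  have "norm (LINT \<xi>|sphere_measure. F \<xi>) \<le> (LINT \<xi>|sphere_measure. norm (F \<xi>))"
    by (rule integral_norm_bound)
  also have "\<dots> \<le> (LINT \<xi>|sphere_measure. 1/2 * indicator ?P \<xi>)"
    by (intro integral_mono integrable_norm Fint integrable_mult_right ind Fle)
  also have "\<dots> = m / 2" using fin by (simp add: m_def)
  finally have 2: "norm (LINT \<xi>|sphere_measure. F \<xi>) \<le> m / 2" .
  have indc: "(\<lambda>\<xi>. indicator ?P \<xi> :: complex) = (\<lambda>\<xi>. of_real (indicator ?P \<xi>))"
    by (auto simp: indicator_def)
  have "fourier_extension (sphere 0 1) (\<lambda>\<xi>. indicator ?P \<xi> * exp (- (\<i> * of_real ((R *\<^sub>R b) \<bullet> \<xi>)))) x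
      = (LINT \<xi>|sphere_measure. exp (\<i> * of_real (y \<bullet> e)) * (F \<xi> + indicator ?P \<xi>))"
    unfolding fourier_extension_def
  proof (intro Bochner_Integration.integral_cong refl)
    fix \<xi>
    have "exp (\<i> * of_real (x \<bullet> \<xi>)) * exp (- (\<i> * of_real ((R *\<^sub>R b) \<bullet> \<xi>)))
        = exp (\<i> * of_real (y \<bullet> e)) * exp (\<i> * of_real (y \<bullet> (\<xi> - e)))"
      unfolding exp_add[symmetric]
      by (rule arg_cong[of _ _ exp]) (simp add: y_def inner_simps algebra_simps)
    then show "exp (\<i> * of_real (x \<bullet> \<xi>)) * (indicator ?P \<xi> * exp (- (\<i> * of_real ((R *\<^sub>R b) \<bullet> \<xi>))))
        = exp (\<i> * of_real (y \<bullet> e)) * (F \<xi> + indicator ?P \<xi>)"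
      by (simp add: F_def indicator_def)
  qed
  also have "\<dots> = exp (\<i> * of_real (y \<bullet> e)) * ((LINT \<xi>|sphere_measure. F \<xi>) + of_real m)"
    unfolding indc using Fint ind by (simp add: m_def)
  also have "norm \<dots> = norm ((LINT \<xi>|sphere_measure. F \<xi>) + of_real m)"
    by (simp add: norm_mult)
  also have "\<dots> \<ge> m - m / 2"
    using norm_triangle_ineq2[of "of_real m" "- (LINT \<xi>|sphere_measure. F \<xi>)"] 2
    by (simp add: m_def add.commute)
  finally show ?thesis using m by (simp add: R_def)
qed

text \<open>The modulated cap indicators are tested with arbitrary signs. Averaging over the signs
  bounds the square function of their extensions, and on each tube the corresponding extension is at
  least \<open>d^2 / 16\<close>, so the square function dominates the number of tubes through a
  point.\<close>

lemma restriction_imp_tube_estimate: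
  fixes b e :: "nat \<times> nat \<Rightarrow> real^3"
  assumes p: "2 \<le> p"
    and restr: "\<And>f. f \<in> Lp_space p sphere_measure \<Longrightarrow>
      fourier_extension (sphere 0 1) f \<in> Lp_space p lborel \<and>
      Lp_norm p lborel (fourier_extension (sphere 0 1) f) \<le> C * Lp_norm p sphere_measure f"
    and d: "0 < d" and J: "finite J" "\<And>i l. (i, l) \<in> J \<Longrightarrow> real (Suc i) * d \<le> 1/2 \<and> real (Suc l) * d \<le> 1/2"
    and e: "\<And>i l. (i, l) \<in> J \<Longrightarrow> e (i, l) \<in> patch (cell d i) (cell d l)"
  shows "(\<integral>\<^sup>+x. ennreal ((\<Sum>j\<in>J. indicator (tube (1 / (8 * d^2)) (1 / (8 * d)) (b j) (e j)) x) powr (p / 2)) \<partial>lborel)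
    \<le> ennreal ((16 / d^2) powr p * \<bar>C\<bar> powr p)"
proof -
  let ?E = "fourier_extension (sphere 0 1)"
  let ?T = "\<lambda>j. tube (1 / (8 * d^2)) (1 / (8 * d)) (b j) (e j)"
  define P where "P j = patch (cell d (fst j)) (cell d (snd j))" for j :: "nat \<times> nat"
  define f where "f j \<xi> = indicator (P j) \<xi> * exp (- (\<i> * of_real (((1 / (8 * d^2)) *\<^sub>R b j) \<bullet> \<xi>)))" for j \<xi>
  have [measurable]: "P j \<in> sets borel" for j unfolding P_def by measurable
  have [measurable]: "(\<lambda>\<xi>. exp (- (\<i> * of_real (c \<bullet> \<xi>)))) \<in> borel_measurable borel" for c :: "real^3"
    by (intro borel_measurable_continuous_onI continuous_intros)
  have [measurable]: "f j \<in> borel_measurable borel" for j unfolding f_def by measurable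
  have normf: "norm (f j \<xi>) = indicator (P j) \<xi>" for j \<xi>
    by (simp add: f_def norm_mult indicator_def)
  have PG: "P j \<subseteq> corner" if "j \<in> J" for j
    using J(2)[of "fst j" "snd j"] that cell_subset[OF d] by (fastforce simp: P_def patch_def)
  have disj: "disjoint_family_on P J"
    unfolding disjoint_family_on_def P_def patch_def using cell_unique[OF d]
    by (auto simp: prod_eq_iff)
  have Ebound: "?E g \<in> borel_measurable lborel" "(\<integral>\<^sup>+x. ennreal (norm (?E g x) powr p) \<partial>lborel) \<le> ennreal (\<bar>C\<bar> powr p)"
    if g: "g \<in> borel_measurable borel" "\<And>\<xi>. norm (g \<xi>) \<le> indicator corner \<xi>" for g
  proof -
    note * = bounded_by_corner[OF g, of p]
    have E: "?E g \<in> Lp_space p lborel" and le: "Lp_norm p lborel (?E g) \<le> C * Lp_norm p sphere_measure g"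
      using restr[OF *(2)] p by auto
    then show "?E g \<in> borel_measurable lborel" by (simp add: Lp_space_def)
    have int: "integrable lborel (\<lambda>x. norm (?E g x) powr p)" using E by (simp add: Lp_space_def)
    let ?I = "LINT x|lborel. norm (?E g x) powr p"
    have I0: "0 \<le> ?I" by simp
    have "?I powr (1 / p) = Lp_norm p lborel (?E g)" by (simp add: Lp_norm_def)
    also have "\<dots> \<le> C * Lp_norm p sphere_measure g" by (rule le)
    also have "\<dots> \<le> \<bar>C\<bar> * 1" using *(3) p by (intro mult_mono) (auto simp: Lp_norm_def)
    finally have "?I powr (1 / p) \<le> \<bar>C\<bar>" by simp
    then have "(?I powr (1 / p)) powr p \<le> \<bar>C\<bar> powr p" using p by (intro powr_mono2) auto
    then have "?I \<le> \<bar>C\<bar> powr p" using p I0 by (simp add: powr_powr)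
    then show "(\<integral>\<^sup>+x. ennreal (norm (?E g x) powr p) \<partial>lborel) \<le> ennreal (\<bar>C\<bar> powr p)"
      by (subst nn_integral_eq_integral[OF int]) (auto intro: ennreal_leI)
  qed
  have fj: "integrable sphere_measure (f j)" "?E (f j) \<in> borel_measurable lborel" if "j \<in> J" for j
  proof -
    have "norm (f j \<xi>) \<le> indicator corner \<xi>" for \<xi>
      using PG[OF that] by (auto simp: normf indicator_def)
    with bounded_by_corner(1)[of "f j" p] Ebound(1)[of "f j"] p
    show "integrable sphere_measure (f j)" "?E (f j) \<in> borel_measurable lborel" by auto
  qed
  have sq: "(\<integral>\<^sup>+x. ennreal (((norm (0::complex))^2 + (\<Sum>j\<in>J. (norm (?E (f j) x))^2)) powr (p / 2)) \<partial>lborel)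
      \<le> ennreal (\<bar>C\<bar> powr p)"
  proof (rule nn_integral_square_function_le[of _ _ _ _ "\<lambda>_. 0"])
    fix \<epsilon> :: "nat \<times> nat \<Rightarrow> real" assume \<epsilon>: "\<And>j. \<epsilon> j = 1 \<or> \<epsilon> j = -1"
    define g where "g \<xi> = (\<Sum>j\<in>J. of_real (\<epsilon> j) * f j \<xi>)" for \<xi>
    have [measurable]: "g \<in> borel_measurable borel" unfolding g_def by measurable
    \<comment> \<open>The caps are disjoint, so at most one term of the signed sum is nonzero; the
      bound does not grow with the number of caps.\<close>
    have "norm (g \<xi>) \<le> indicator corner \<xi>" for \<xi>
    proof -
      have "norm (g \<xi>) \<le> (\<Sum>j\<in>J. norm (of_real (\<epsilon> j) * f j \<xi>))" unfolding g_def by (rule norm_sum)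
      also have "\<dots> = (\<Sum>j\<in>J. indicator (P j) \<xi>)"
      proof (intro sum.cong refl)
        fix j show "norm (of_real (\<epsilon> j) * f j \<xi>) = indicator (P j) \<xi>"
          using \<epsilon>[of j] by (auto simp: norm_mult normf)
      qed
      also have "\<dots> = indicator (\<Union>j\<in>J. P j) \<xi>" using J(1) disj by (simp add: indicator_UN_disjoint)
      also have "\<dots> \<le> indicator corner \<xi>" using PG by (auto simp: indicator_def)
      finally show ?thesis .
    qed
    then have "(\<integral>\<^sup>+x. ennreal (norm (?E g x) powr p) \<partial>lborel) \<le> ennreal (\<bar>C\<bar> powr p)"
      by (intro Ebound) auto
    moreover have "?E g x = (\<Sum>j\<in>J. of_real (\<epsilon> j) * ?E (f j) x)" for x
    proof -
      have [measurable]: "(\<lambda>\<xi>. exp (\<i> * of_real (x \<bullet> \<xi>))) \<in> borel_measurable borel"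
        by (intro borel_measurable_continuous_onI continuous_intros)
      have int: "integrable sphere_measure (\<lambda>\<xi>. exp (\<i> * of_real (x \<bullet> \<xi>)) * f j \<xi>)" if "j \<in> J" for j
        by (rule Bochner_Integration.integrable_bound[OF fj(1)[OF that]]) (auto simp: norm_mult)
      have "?E g x = (LINT \<xi>|sphere_measure. (\<Sum>j\<in>J. of_real (\<epsilon> j) * (exp (\<i> * of_real (x \<bullet> \<xi>)) * f j \<xi>)))"
        unfolding fourier_extension_def g_def
        by (intro Bochner_Integration.integral_cong refl) (simp add: sum_distrib_left mult_ac)
      also have "\<dots> = (\<Sum>j\<in>J. of_real (\<epsilon> j) * ?E (f j) x)"
        unfolding fourier_extension_def
        by (subst Bochner_Integration.integral_sum) (auto intro!: integrable_mult_right int)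
      finally show ?thesis .
    qed
    ultimately show "(\<integral>\<^sup>+x. ennreal (((norm (0 + (\<Sum>j\<in>J. of_real (\<epsilon> j) * ?E (f j) x)))^2) powr (p / 2)) \<partial>lborel)
        \<le> ennreal (\<bar>C\<bar> powr p)"
      by (simp add: powr_powr flip: powr_numeral)
  qed (use J p fj in auto)
  have "(\<integral>\<^sup>+x. ennreal ((\<Sum>j\<in>J. indicator (?T j) x) powr (p / 2)) \<partial>lborel)
      \<le> (\<integral>\<^sup>+x. ennreal ((16 / d^2) powr p) * ennreal ((\<Sum>j\<in>J. (norm (?E (f j) x))^2) powr (p / 2)) \<partial>lborel)"
  proof (intro nn_integral_mono)
    fix x
    \<comment> \<open>Squaring the lower bound on the tube gives the factor
      \<open>(16 / d^2)^2\<close>, which becomes \<open>(16 / d^2) powr p\<close> after raising to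
      the power \<open>p / 2\<close>.\<close>
    have "indicator (?T j) x \<le> (16 / d^2)^2 * (norm (?E (f j) x))^2" if "j \<in> J" for j
    proof (cases "x \<in> ?T j")
      case True
      have "d^2 / 16 \<le> norm (?E (f j) x)"
        unfolding f_def P_def using J(2)[of "fst j" "snd j"] e[of "fst j" "snd j"] that d True
        by (intro fourier_extension_cap_ge) auto
      then have "1 \<le> 16 / d^2 * norm (?E (f j) x)" using d by (simp add: field_simps)
      then have "1^2 \<le> (16 / d^2 * norm (?E (f j) x))^2" by (intro power_mono) auto
      then show ?thesis using True unfolding power_mult_distrib by simp
    qed simp
    then have "(\<Sum>j\<in>J. indicator (?T j) x) \<le> (16 / d^2)^2 * (\<Sum>j\<in>J. (norm (?E (f j) x))^2)"
      unfolding sum_distrib_left by (rule sum_mono)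
    then have "(\<Sum>j\<in>J. indicator (?T j) x) powr (p / 2) \<le> ((16 / d^2)^2 * (\<Sum>j\<in>J. (norm (?E (f j) x))^2)) powr (p / 2)"
      using p by (intro powr_mono2 sum_nonneg) auto
    also have "\<dots> = (16 / d^2) powr p * (\<Sum>j\<in>J. (norm (?E (f j) x))^2) powr (p / 2)"
    proof -
      have "((16 / d^2)^2) powr (p / 2) = (16 / d^2) powr p"
        using d by (simp add: powr_powr flip: powr_numeral)
      then show ?thesis by (subst powr_mult) (auto intro: sum_nonneg)
    qed
    finally show "ennreal ((\<Sum>j\<in>J. indicator (?T j) x) powr (p / 2))
        \<le> ennreal ((16 / d^2) powr p) * ennreal ((\<Sum>j\<in>J. (norm (?E (f j) x))^2) powr (p / 2))"
      by (simp add: ennreal_mult'[symmetric] ennreal_leI)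
  qed
  also have "\<dots> = ennreal ((16 / d^2) powr p) * (\<integral>\<^sup>+x. ennreal ((\<Sum>j\<in>J. (norm (?E (f j) x))^2) powr (p / 2)) \<partial>lborel)"
    by (intro nn_integral_cmult) (use fj(2) in measurable)
  also have "\<dots> \<le> ennreal ((16 / d^2) powr p) * ennreal (\<bar>C\<bar> powr p)"
    using sq by (intro mult_left_mono) auto
  also have "\<dots> = ennreal ((16 / d^2) powr p * \<bar>C\<bar> powr p)" by (simp add: ennreal_mult')
  finally show ?thesis .
qed

section \<open>Scales of a cover of a Kakeya set\<close>

text \<open>If every piece had measure at most its weight, countable subadditivity would make
  \<open>A\<close> too small. The lemma serves both along a segment and among the
  directions.\<close>

lemma measure_pigeonhole:
  fixes w :: "nat \<Rightarrow> real"
  assumes B: "\<And>k. B k \<in> sets M" and Z: "Z \<in> null_sets M"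
    and cover: "A \<subseteq> (\<Union>k\<in>{k\<^sub>0..}. B k) \<union> Z"
    and less: "(\<Sum>k. ennreal (w (k + k\<^sub>0))) < emeasure M A"
  shows "\<exists>k\<ge>k\<^sub>0. ennreal (w k) < emeasure M (B k)"
proof (rule ccontr)
  assume "\<not> ?thesis"
  then have le: "emeasure M (B k) \<le> ennreal (w k)" if "k\<^sub>0 \<le> k" for k using that by auto
  have "A \<subseteq> (\<Union>k. B (k + k\<^sub>0)) \<union> Z"
  proof
    fix x assume "x \<in> A"
    then consider "x \<in> Z" | k where "k\<^sub>0 \<le> k" "x \<in> B ((k - k\<^sub>0) + k\<^sub>0)" using cover by fastforce
    then show "x \<in> (\<Union>k. B (k + k\<^sub>0)) \<union> Z" by cases blast+
  qed
  then have "emeasure M A \<le> emeasure M ((\<Union>k. B (k + k\<^sub>0)) \<union> Z)"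
    using B Z by (intro emeasure_mono sets.Un sets.countable_UN) auto
  also have "\<dots> = emeasure M (\<Union>k. B (k + k\<^sub>0))"
    using B Z by (intro emeasure_Un_null_set sets.countable_UN) auto
  also have "\<dots> \<le> (\<Sum>k. emeasure M (B (k + k\<^sub>0)))"
    using B by (intro emeasure_subadditive_countably) auto
  also have "\<dots> \<le> (\<Sum>k. ennreal (w (k + k\<^sub>0)))" using le by (intro suminf_le) auto
  finally show False using less by auto
qed

lemma ennreal_less_ennrealD: "ennreal a < ennreal b \<Longrightarrow> a < b"
  by (metis ennreal_leI not_less)

definition scale_class :: "(nat \<Rightarrow> (real^3) set) \<Rightarrow> nat \<Rightarrow> nat set" where
  "scale_class C k = {n. (1/2)^Suc k < diameter (C n) \<and> diameter (C n) \<le> (1/2)^k}"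

text \<open>The covering sets are arbitrary and their traces on a segment need not be measurable.
  Counting parameter cells replaces such a trace by a finite union of intervals.\<close>

definition hit_cells :: "(nat \<Rightarrow> (real^3) set) \<Rightarrow> nat \<Rightarrow> real^3 \<Rightarrow> real^3 \<Rightarrow> nat set" where
  "hit_cells C k b e = {i. i < 2^k \<and> (\<exists>t \<in> cell ((1/2)^k) i. \<exists>n \<in> scale_class C k. b + t *\<^sub>R e \<in> C n)}"

lemma scale_class_exists:
  assumes "0 < diameter (C n)" "diameter (C n) \<le> (1/2)^k\<^sub>0"
  shows "\<exists>k\<ge>k\<^sub>0. n \<in> scale_class C k"
proof -
  \<comment> \<open>The wanted class index is the predecessor of \<open>m\<close>, the first
    exponent whose dyadic size drops below the diameter.\<close>
  define m where "m = (LEAST m. (1/2)^m < diameter (C n))"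
  have "\<exists>k. (1/2)^k < diameter (C n)" using assms(1) by (intro real_arch_pow_inv) auto
  then have m: "(1/2)^m < diameter (C n)" "\<And>k. k < m \<Longrightarrow> \<not> (1/2)^k < diameter (C n)"
    unfolding m_def by (rule LeastI_ex) (rule not_less_Least)
  have "k\<^sub>0 < m"
  proof (rule ccontr)
    assume "\<not> k\<^sub>0 < m"
    then have "(1/2::real)^k\<^sub>0 \<le> (1/2)^m" by (intro power_decreasing) auto
    then show False using m(1) assms(2) by linarith
  qed
  then obtain k where "m = Suc k" "k\<^sub>0 \<le> k" by (metis Suc_le_D Suc_le_lessD Suc_le_mono less_Suc_eq_le not0_implies_Suc not_less0)
  then show ?thesis using m(1) m(2)[of k] by (auto simp: scale_class_def not_less)
qed

lemma emeasure_cell: "0 \<le> d \<Longrightarrow> emeasure lborel (cell d i) = ennreal d"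
  by (simp add: cell_def algebra_simps mult_right_mono)

text \<open>First pigeonholing: up to a null set, the parameter interval is the union over
  \<open>k\<close> of the cells hit by sets of class \<open>k\<close>. Some class therefore exceeds
  its weight, and its measure is at most the number of hit cells times their length.\<close>

lemma hit_cells_pigeonhole:
  fixes w :: "nat \<Rightarrow> real"
  assumes bd: "\<And>n. bounded (C n)" and diam: "\<And>n. diameter (C n) \<le> (1/2)^k\<^sub>0"
    and e: "e \<noteq> 0" and seg: "closed_segment b (b + e) \<subseteq> (\<Union>n. C n)"
    and w: "(\<Sum>k. ennreal (w (k + k\<^sub>0))) < 1"
  shows "\<exists>k\<ge>k\<^sub>0. w k < real (card (hit_cells C k b e)) * (1/2)^k"
proof -
  define B where "B k = (\<Union>i\<in>hit_cells C k b e. cell ((1/2)^k) i)" for k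
  have fin: "finite (hit_cells C k b e)" for k by (simp add: hit_cells_def)
  \<comment> \<open>Sets of diameter \<open>0\<close> belong to no scale class, but only meet the segment in countably many points.\<close>
  define Z where "Z = {t. \<exists>n. diameter (C n) = 0 \<and> b + t *\<^sub>R e \<in> C n}"
  have "Z = (\<Union>n\<in>{n. diameter (C n) = 0}. {t. b + t *\<^sub>R e \<in> C n})" by (auto simp: Z_def)
  also have "countable \<dots>"
  proof (intro countable_UN)
    fix n assume "n \<in> {n. diameter (C n) = 0}"
    then have eq: "x = y" if "x \<in> C n" "y \<in> C n" for x y
      using diameter_bounded_bound[OF bd that] by simp
    have "s = t" if "b + s *\<^sub>R e \<in> C n" "b + t *\<^sub>R e \<in> C n" for s t
      using eq[OF that] e by simp
    then have "{t. b + t *\<^sub>R e \<in> C n} = {} \<or> (\<exists>s. {t. b + t *\<^sub>R e \<in> C n} = {s})" by blast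
    then show "countable {t. b + t *\<^sub>R e \<in> C n}" by auto
  qed auto
  finally have Z: "Z \<in> null_sets lborel" by (rule countable_imp_null_set_lborel)
  have "\<exists>k\<ge>k\<^sub>0. ennreal (w k) < emeasure lborel (B k)"
  proof (rule measure_pigeonhole[OF _ Z])
    show "{0..<1} \<subseteq> (\<Union>k\<in>{k\<^sub>0..}. B k) \<union> Z"
    proof
      fix t :: real assume t: "t \<in> {0..<1}"
      then have "b + t *\<^sub>R e \<in> closed_segment b (b + e)"
        unfolding in_segment by (intro exI[of _ t]) (auto simp: algebra_simps)
      then obtain n where n: "b + t *\<^sub>R e \<in> C n" using seg by auto
      show "t \<in> (\<Union>k\<in>{k\<^sub>0..}. B k) \<union> Z"
      proof (cases "diameter (C n) = 0")
        case False
        then have "0 < diameter (C n)" using diameter_ge_0[OF bd, of n] by linarith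
        then obtain k where k: "k\<^sub>0 \<le> k" "n \<in> scale_class C k"
          using scale_class_exists diam by blast
        obtain i where "i < 2^k" "t \<in> cell ((1/2)^k) i"
          using cell_cover[of "(1/2)^k" t "2^k"] t by (auto simp: power_mult_distrib[symmetric])
        then have "i \<in> hit_cells C k b e" using k n by (auto simp: hit_cells_def)
        then show ?thesis using k \<open>t \<in> cell ((1/2)^k) i\<close> by (auto simp: B_def)
      qed (use n in \<open>auto simp: Z_def\<close>)
    qed
    show "(\<Sum>k. ennreal (w (k + k\<^sub>0))) < emeasure lborel {0..<1::real}" using w by simp
  qed (auto simp: B_def)
  then obtain k where k: "k\<^sub>0 \<le> k" "ennreal (w k) < emeasure lborel (B k)" by blast
  have "emeasure lborel (B k) \<le> (\<Sum>i\<in>hit_cells C k b e. emeasure lborel (cell ((1/2)^k) i))"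
    unfolding B_def using fin by (intro emeasure_subadditive_finite) auto
  also have "\<dots> = ennreal (real (card (hit_cells C k b e)) * (1/2)^k)"
    by (simp add: emeasure_cell ennreal_mult ennreal_of_nat_eq_real_of_nat del: ennreal_half)
  finally have "emeasure lborel (B k) \<le> ennreal (real (card (hit_cells C k b e)) * (1/2)^k)" .
  then have "ennreal (w k) < ennreal (real (card (hit_cells C k b e)) * (1/2)^k)"
    by (rule less_le_trans[OF k(2)])
  then have "w k < real (card (hit_cells C k b e)) * (1/2)^k" by (rule ennreal_less_ennrealD)
  then show ?thesis using k(1) by blast
qed

text \<open>Second pigeonholing: every direction over the square of area \<open>1/4\<close> has a
  good scale by the first one, and the direction cells are sorted by it. The bound
  \<open>1/4\<close> on the weights is the area of this square and also suffices on a segment of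
  length 1.\<close>

lemma Kakeya_scale_exists:
  fixes w :: "nat \<Rightarrow> real"
  assumes K: "Kakeya_set K" "K \<subseteq> (\<Union>n. C n)"
    and bd: "\<And>n. bounded (C n)" and diam: "\<And>n. diameter (C n) \<le> (1/2)^k\<^sub>0"
    and k0: "1 \<le> k\<^sub>0" and w: "(\<Sum>k. ennreal (w (k + k\<^sub>0))) < ennreal (1/4)"
  obtains k J b e where "k\<^sub>0 \<le> k" "finite J"
    "\<And>i l. (i, l) \<in> J \<Longrightarrow> real (Suc i) * (1/2)^k \<le> 1/2 \<and> real (Suc l) * (1/2)^k \<le> 1/2"
    "\<And>i l. (i, l) \<in> J \<Longrightarrow> e (i, l) \<in> patch (cell ((1/2)^k) i) (cell ((1/2)^k) l)"
    "w k < real (card J) * ((1/2)^k)^2"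
    "\<And>j. j \<in> J \<Longrightarrow> w k < real (card (hit_cells C k (b j) (e j))) * (1/2)^k"
proof -
  have "\<exists>b k. k\<^sub>0 \<le> k \<and> w k < real (card (hit_cells C k b e)) * (1/2)^k" if e: "norm e = 1" for e
  proof -
    obtain b where "closed_segment b (b + e) \<subseteq> K" using K(1) e by (auto simp: Kakeya_set_def)
    then show ?thesis
      using hit_cells_pigeonhole[where C=C and b=b and e=e and w=w and k\<^sub>0=k\<^sub>0] bd diam e K(2) w
      by (force dest: less_trans[of _ "ennreal (1/4)" 1])
  qed
  then obtain b \<kappa> where bk: "\<And>e. norm e = 1 \<Longrightarrow> k\<^sub>0 \<le> \<kappa> e"
    "\<And>e. norm e = 1 \<Longrightarrow> w (\<kappa> e) < real (card (hit_cells C (\<kappa> e) (b e) e)) * (1/2)^\<kappa> e"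
    by metis
  define D where "D k i = cell ((1/2)^k) i" for k i
  define J where "J k = {(i, l). i < 2^(k-1) \<and> l < 2^(k-1) \<and> (\<exists>e \<in> patch (D k i) (D k l). \<kappa> e = k)}" for k
  have finJ: "finite (J k)" for k
    by (rule finite_subset[of _ "{..<2^(k-1)} \<times> {..<2^(k-1)}"]) (auto simp: J_def)
  define S where "S k = (\<Union>(i,l)\<in>J k. D k i \<times> D k l)" for k
  have [measurable]: "D k i \<in> sets borel" for k i by (simp add: D_def)
  have DD: "D k i \<times> D k l \<in> sets (lborel :: (real \<times> real) measure)" for k i l
    unfolding lborel_prod[symmetric] by auto
  have "\<exists>k\<ge>k\<^sub>0. ennreal (w k) < emeasure lborel (S k)"
  proof (rule measure_pigeonhole[of _ _ "{}"])
    show "S k \<in> sets lborel" for k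
      unfolding S_def using DD finJ by (intro sets.finite_UN) (auto split: prod.split)
    show "{0..<1/2} \<times> {0..<1/2} \<subseteq> (\<Union>k\<in>{k\<^sub>0..}. S k) \<union> {}"
    proof
      fix z :: "real \<times> real" assume "z \<in> {0..<1/2} \<times> {0..<1/2}"
      then obtain x y where z: "z = (x, y)" and xy: "x \<in> {0..<1/2}" "y \<in> {0..<1/2}" by blast
      obtain e where e: "e \<in> patch {x} {y}" using patch_point[of x "{x}" y "{y}"] xy by auto
      then have "norm e = 1" by (simp add: patch_def)
      define k where "k = \<kappa> e"
      have k: "k\<^sub>0 \<le> k" using bk(1)[OF \<open>norm e = 1\<close>] by (simp add: k_def)
      then obtain m where m: "k = Suc m" using k0 by (metis One_nat_def Suc_le_D order_trans)
      have half: "real (2^(k-1)) * (1/2)^k = 1/2" by (simp add: m power_mult_distrib[symmetric])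
      obtain i l where il: "i < 2^(k-1)" "x \<in> D k i" "l < 2^(k-1)" "y \<in> D k l"
        using cell_cover[of "(1/2)^k" x "2^(k-1)"] cell_cover[of "(1/2)^k" y "2^(k-1)"] xy half
        unfolding D_def by auto
      then have "e \<in> patch (D k i) (D k l)" using e by (simp add: patch_def)
      then have "(i, l) \<in> J k" using il by (auto simp: J_def k_def)
      then show "z \<in> (\<Union>k\<in>{k\<^sub>0..}. S k) \<union> {}" using il k unfolding S_def z by fastforce
    qed
    show "(\<Sum>k. ennreal (w (k + k\<^sub>0))) < emeasure lborel ({0..<1/2} \<times> {0..<1/2} :: (real \<times> real) set)"
      using w unfolding lborel_prod[symmetric]
      by (simp add: lborel.emeasure_pair_measure_Times ennreal_mult[symmetric] del: ennreal_half)
  qed simp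
  then obtain k where k: "k\<^sub>0 \<le> k" "ennreal (w k) < emeasure lborel (S k)" by blast
  have "emeasure lborel (S k) \<le> (\<Sum>j\<in>J k. emeasure lborel (D k (fst j) \<times> D k (snd j)))"
    unfolding S_def split_def using finJ DD by (intro emeasure_subadditive_finite) auto
  also have "\<dots> = (\<Sum>j\<in>J k. ennreal (((1/2)^k)^2))"
    unfolding lborel_prod[symmetric]
    by (simp add: lborel.emeasure_pair_measure_Times D_def emeasure_cell ennreal_mult[symmetric] power2_eq_square del: ennreal_half)
  also have "\<dots> = ennreal (real (card (J k)) * ((1/2)^k)^2)"
    by (simp add: ennreal_mult ennreal_of_nat_eq_real_of_nat del: ennreal_half)
  finally have "emeasure lborel (S k) \<le> ennreal (real (card (J k)) * ((1/2)^k)^2)" .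
  then have wk: "w k < real (card (J k)) * ((1/2)^k)^2"
    by (intro ennreal_less_ennrealD less_le_trans[OF k(2)])
  define e where "e j = (SOME e. e \<in> patch (D k (fst j)) (D k (snd j)) \<and> \<kappa> e = k)" for j
  have e: "e j \<in> patch (D k (fst j)) (D k (snd j)) \<and> \<kappa> (e j) = k" if "j \<in> J k" for j
    unfolding e_def by (rule someI_ex) (use that in \<open>auto simp: J_def\<close>)
  obtain m where m: "k = Suc m" using k(1) k0 by (metis One_nat_def Suc_le_D order_trans)
  have le: "real (Suc i) * (1/2)^k \<le> 1/2" if "i < 2^(k-1)" for i
  proof -
    have "real (Suc i) \<le> 2^m" using that m by (metis Suc_le_eq diff_Suc_1 of_nat_le_iff of_nat_numeral of_nat_power)
    then have "real (Suc i) * (1/2)^k \<le> 2^m * (1/2)^k" by (intro mult_right_mono) auto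
    then show ?thesis by (simp add: m power_mult_distrib[symmetric])
  qed
  show thesis
  proof (rule that[of k "J k" e "b \<circ> e", OF k(1) finJ _ _ wk])
    show "real (Suc i) * (1/2)^k \<le> 1/2 \<and> real (Suc l) * (1/2)^k \<le> 1/2" if "(i, l) \<in> J k" for i l
      using that le by (auto simp: J_def)
    show "e (i, l) \<in> patch (cell ((1/2)^k) i) (cell ((1/2)^k) l)" if "(i, l) \<in> J k" for i l
      using e[OF that] by (simp add: D_def)
    show "w k < real (card (hit_cells C k ((b \<circ> e) j) (e j))) * (1/2)^k" if "j \<in> J k" for j
      using bk(2)[of "e j"] e[OF that] by (auto simp: patch_def)
  qed
qed

section \<open>Volume of the overlap\<close>

text \<open>A substitute for Hoelder's inequality; the level \<open>l\<close> is optimised at the end.\<close>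

lemma le_level_plus_power:
  fixes F l q :: real
  assumes "0 \<le> F" "0 < l" "1 \<le> q"
  shows "F \<le> l + l powr (1 - q) * F powr q"
proof (cases "F \<le> l")
  case False
  then have F: "F = F powr (1 - q) * F powr q" using assms by (simp flip: powr_add)
  also have "\<dots> \<le> l powr (1 - q) * F powr q"
    using assms False by (intro mult_right_mono powr_mono2') auto
  finally show ?thesis using assms by linarith
next
  case True
  moreover have "0 \<le> l powr (1 - q) * F powr q" by simp
  ultimately show ?thesis by linarith
qed

text \<open>Each set of the class costs at least \<open>((1/2)^Suc k) powr s\<close>, and the total
  cost is below 1. The resulting bound is uniform over finite subsets, which also yields
  finiteness.\<close>

lemma scale_class_card:
  assumes bd: "\<And>n. bounded (C n)" and s: "0 < s" and sum: "(\<Sum>n. diam_cost s (C n)) < 1"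
  shows "finite (scale_class C k)" "real (card (scale_class C k)) \<le> (2 / (1/2)^k) powr s"
proof -
  let ?d = "(1/2)^Suc k :: real"
  have bound: "real (card F) \<le> (2 / (1/2)^k) powr s" if F: "finite F" "F \<subseteq> scale_class C k" for F
  proof -
    have "ennreal (?d powr s) \<le> diam_cost s (C n)" if "n \<in> F" for n
    proof -
      have "?d < diameter (C n)" using that F by (auto simp: scale_class_def)
      moreover have "(0::real) < ?d" by simp
      ultimately have "C n \<noteq> {}" "?d powr s \<le> diameter (C n) powr s"
        using s by (auto simp del: power_Suc intro!: powr_mono2)
      then show ?thesis using s by (auto simp: diam_cost_def intro!: ennreal_leI simp del: power_Suc)
    qed
    then have "(\<Sum>n\<in>F. ennreal (?d powr s)) \<le> (\<Sum>n\<in>F. diam_cost s (C n))" by (rule sum_mono)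
    also have "\<dots> \<le> (\<Sum>n. diam_cost s (C n))" using F by (intro sum_le_suminf summableI) auto
    also have "\<dots> < ennreal 1" using sum by simp
    finally have "ennreal (real (card F) * ?d powr s) < ennreal 1"
      by (simp add: ennreal_mult ennreal_of_nat_eq_real_of_nat)
    then have "real (card F) * ?d powr s < 1" by (rule ennreal_less_ennrealD)
    then have "real (card F) < 1 / ?d powr s" by (subst pos_less_divide_eq) auto
    also have "1 / ?d powr s = (2 / (1/2)^k) powr s" by (simp add: powr_divide)
    finally show ?thesis by simp
  qed
  have "card F \<le> nat \<lfloor>(2 / (1/2::real)^k) powr s\<rfloor>" if "finite F" "F \<subseteq> scale_class C k" for F
    using bound[OF that] by (simp add: le_nat_floor)
  then show "finite (scale_class C k)" by (rule finite_if_finite_subsets_card_bdd[THEN conjunct1])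
  then show "real (card (scale_class C k)) \<le> (2 / (1/2)^k) powr s" by (intro bound) auto
qed

lemma emeasure_ball3: "0 \<le> r \<Longrightarrow> emeasure lborel (ball (c::real^3) r) = ennreal (unit_ball_vol 3 * r^3)"
  by (subst emeasure_ball) auto

lemma emeasure_cball3: "0 \<le> r \<Longrightarrow> emeasure lborel (cball (c::real^3) r) = ennreal (unit_ball_vol 3 * r^3)"
  by (subst emeasure_cball) auto

text \<open>Each hit cell contributes a ball of radius \<open>R * d / 2\<close> around its dilated
  midpoint. These balls lie in the tube, are disjoint because the centres are at least
  \<open>R * d\<close> apart, and stay near the dilated covering set that hits the cell.\<close>

lemma tube_hit_volume_ge:
  fixes b e :: "real^3"
  assumes d_def: "d = (1/2::real)^k" and bd: "\<And>n. bounded (C n)" and fin: "finite (scale_class C k)"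
    and c: "\<And>n. n \<in> scale_class C k \<Longrightarrow> c n \<in> C n"
    and e: "norm e = 1" and R: "0 < R"
  shows "ennreal (real (card (hit_cells C k b e)) * (unit_ball_vol 3 * (R * d / 2)^3))
    \<le> emeasure lborel (tube R (R * d) b e \<inter> (\<Union>n\<in>scale_class C k. cball (R *\<^sub>R c n) (2 * (R * d))))"
proof -
  let ?H = "hit_cells C k b e"
  let ?K = "\<Union>n\<in>scale_class C k. cball (R *\<^sub>R c n) (2 * (R * d))"
  have d: "0 < d" by (simp add: d_def)
  define t where "t i = (real i + 1/2) * d" for i
  define B where "B i = ball (R *\<^sub>R (b + t i *\<^sub>R e)) (R * d / 2)" for i
  have fH: "finite ?H" by (simp add: hit_cells_def)
  have sub: "B i \<subseteq> tube R (R * d) b e \<inter> ?K" if i: "i \<in> ?H" for i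
  proof
    fix x assume "x \<in> B i"
    then have x: "norm (x - R *\<^sub>R (b + t i *\<^sub>R e)) < R * d / 2"
      by (simp add: B_def dist_norm norm_minus_commute)
    obtain u n where i2: "i < 2^k" and u: "u \<in> cell d i" and n: "n \<in> scale_class C k" "b + u *\<^sub>R e \<in> C n"
      using i by (auto simp: hit_cells_def d_def)
    have "real (Suc i) \<le> 2^k" using i2 by (metis Suc_leI of_nat_le_iff of_nat_numeral of_nat_power)
    then have "real (Suc i) * d \<le> 2^k * d" using d by (intro mult_right_mono) auto
    also have "\<dots> = 1" by (simp add: d_def power_mult_distrib[symmetric])
    finally have "t i \<in> {0..1}" using d by (simp add: t_def algebra_simps)
    moreover have "norm (x - R *\<^sub>R (b + t i *\<^sub>R e)) \<le> R * d" using x R d by (smt (verit) mult_pos_pos field_sum_of_halves)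
    ultimately have 1: "x \<in> tube R (R * d) b e" by (auto simp: tube_def)
    have "norm ((b + u *\<^sub>R e) - c n) \<le> d"
      using diameter_bounded_bound[OF bd n(2) c[OF n(1)]] n(1) by (auto simp: scale_class_def d_def dist_norm)
    moreover have "norm ((t i - u) *\<^sub>R e) \<le> d / 2"
    proof -
      have "t i = real i * d + d / 2" "real i * d \<le> u" "u < real i * d + d"
        using u by (auto simp: t_def cell_def algebra_simps)
      then have "\<bar>t i - u\<bar> \<le> d / 2" unfolding abs_le_iff by linarith
      then show ?thesis using e by simp
    qed
    \<comment> \<open>From the midpoint to the hit point is at most \<open>d / 2\<close>, and from
      there to \<open>c n\<close> at most \<open>d\<close>. With the ball radius, the distance after
      dilation is at most \<open>2 * (R * d)\<close>.\<close>
    ultimately have "norm ((t i - u) *\<^sub>R e + ((b + u *\<^sub>R e) - c n)) \<le> d / 2 + d"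
      by (intro norm_triangle_mono) auto
    then have "R * norm ((t i - u) *\<^sub>R e + ((b + u *\<^sub>R e) - c n)) \<le> R * (d / 2 + d)"
      using R by (intro mult_left_mono) auto
    then have "norm (R *\<^sub>R ((t i - u) *\<^sub>R e + ((b + u *\<^sub>R e) - c n))) \<le> R * (d / 2 + d)"
      using R by simp
    then have "norm ((x - R *\<^sub>R (b + t i *\<^sub>R e)) + R *\<^sub>R ((t i - u) *\<^sub>R e + ((b + u *\<^sub>R e) - c n))) \<le> R * d / 2 + R * (d / 2 + d)"
      using x by (intro norm_triangle_mono) auto
    also have "(x - R *\<^sub>R (b + t i *\<^sub>R e)) + R *\<^sub>R ((t i - u) *\<^sub>R e + ((b + u *\<^sub>R e) - c n)) = x - R *\<^sub>R c n"
      by (simp add: algebra_simps)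
    finally have "x \<in> cball (R *\<^sub>R c n) (2 * (R * d))" by (simp add: dist_norm norm_minus_commute algebra_simps)
    then show "x \<in> tube R (R * d) b e \<inter> ?K" using 1 n by blast
  qed
  have disj: "disjoint_family_on B ?H"
    unfolding disjoint_family_on_def
  proof (intro ballI impI)
    fix i j assume "i \<in> ?H" "j \<in> ?H" "i \<noteq> j"
    have eq: "R *\<^sub>R (b + t i *\<^sub>R e) - R *\<^sub>R (b + t j *\<^sub>R e) = ((real i - real j) * (R * d)) *\<^sub>R e"
      by (simp add: t_def algebra_simps)
    have "1 * (R * d) \<le> \<bar>real i - real j\<bar> * (R * d)"
      using \<open>i \<noteq> j\<close> R d by (intro mult_right_mono) auto
    then have far: "R * d \<le> dist (R *\<^sub>R (b + t i *\<^sub>R e)) (R *\<^sub>R (b + t j *\<^sub>R e))"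
      unfolding dist_norm eq using e R d by (simp add: abs_mult)
    show "B i \<inter> B j = {}"
      unfolding B_def by (rule disjoint_ballI) (use far in simp)
  qed
  have "ennreal (real (card ?H) * (unit_ball_vol 3 * (R * d / 2)^3)) = (\<Sum>i\<in>?H. emeasure lborel (B i))"
    using R d by (simp add: B_def emeasure_ball3 ennreal_mult ennreal_of_nat_eq_real_of_nat)
  also have "\<dots> = emeasure lborel (\<Union>i\<in>?H. B i)"
    by (rule sum_emeasure[OF _ disj fH]) (auto simp: B_def)
  also have "\<dots> \<le> emeasure lborel (tube R (R * d) b e \<inter> ?K)"
    using sub fin by (intro emeasure_mono) auto
  finally show ?thesis .
qed

text \<open>The integral of the overlap function \<open>F\<close> over \<open>K\<close> is counted
  twice. From below, each tube has a large part in \<open>K\<close>; from above, \<open>F\<close> is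
  at most the level \<open>l\<close> plus a multiple of its power \<open>q\<close>, whose integral
  \<open>est\<close> controls.\<close>

lemma tube_incidence_bound:
  fixes b e :: "'j \<Rightarrow> real^3"
  assumes d_def: "d = (1/2::real)^k" and bd: "\<And>n. bounded (C n)" and fin: "finite (scale_class C k)"
    and J: "finite J" and e: "\<And>j. j \<in> J \<Longrightarrow> norm (e j) = 1" and R: "0 < R"
    and hit: "\<And>j. j \<in> J \<Longrightarrow> h \<le> real (card (hit_cells C k (b j) (e j)))" "0 \<le> h"
    and est: "(\<integral>\<^sup>+x. ennreal ((\<Sum>j\<in>J. indicator (tube R (R * d) (b j) (e j)) x) powr q) \<partial>lborel) \<le> ennreal A"
    and l: "0 < l" and q: "1 \<le> q" and A: "0 \<le> A"
  shows "real (card J) * (h * (unit_ball_vol 3 * (R * d / 2)^3))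
    \<le> l * (real (card (scale_class C k)) * (unit_ball_vol 3 * (2 * (R * d))^3)) + l powr (1 - q) * A"
proof -
  have d: "0 < d" by (simp add: d_def)
  define c where "c n = (SOME x. x \<in> C n)" for n
  have c: "c n \<in> C n" if "n \<in> scale_class C k" for n
  proof -
    have "(1/2)^Suc k < diameter (C n)" using that by (simp add: scale_class_def)
    then have "0 < diameter (C n)" by (rule less_trans[rotated]) simp
    then have "C n \<noteq> {}" by auto
    then show ?thesis unfolding c_def by (rule some_in_eq[THEN iffD2])
  qed
  define K where "K = (\<Union>n\<in>scale_class C k. cball (R *\<^sub>R c n) (2 * (R * d)))"
  have [measurable]: "K \<in> sets borel" unfolding K_def using fin by (intro sets.finite_UN) auto
  let ?T = "\<lambda>j. tube R (R * d) (b j) (e j)"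
  define F :: "real^3 \<Rightarrow> real" where "F x = (\<Sum>j\<in>J. indicator (?T j) x)" for x
  have F0: "0 \<le> F x" for x by (simp add: F_def sum_nonneg)
  have [measurable]: "F \<in> borel_measurable borel" unfolding F_def by measurable
  have Kle: "emeasure lborel K \<le> ennreal (real (card (scale_class C k)) * (unit_ball_vol 3 * (2 * (R * d))^3))"
  proof -
    have "emeasure lborel K \<le> (\<Sum>n\<in>scale_class C k. emeasure lborel (cball (R *\<^sub>R c n) (2 * (R * d))))"
      unfolding K_def using fin by (intro emeasure_subadditive_finite) auto
    also have "\<dots> = ennreal (real (card (scale_class C k)) * (unit_ball_vol 3 * (2 * (R * d))^3))"
      using R d by (simp add: emeasure_cball3 ennreal_mult ennreal_of_nat_eq_real_of_nat)
    finally show ?thesis .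
  qed
  have "ennreal (real (card J) * (h * (unit_ball_vol 3 * (R * d / 2)^3)))
      = (\<Sum>j\<in>J. ennreal (h * (unit_ball_vol 3 * (R * d / 2)^3)))"
    using hit(2) R d by (simp add: ennreal_mult ennreal_of_nat_eq_real_of_nat)
  also have "\<dots> \<le> (\<Sum>j\<in>J. emeasure lborel (?T j \<inter> K))"
  proof (intro sum_mono)
    fix j assume j: "j \<in> J"
    have "ennreal (h * (unit_ball_vol 3 * (R * d / 2)^3))
        \<le> ennreal (real (card (hit_cells C k (b j) (e j))) * (unit_ball_vol 3 * (R * d / 2)^3))"
      using hit(1)[OF j] R d by (intro ennreal_leI mult_right_mono) auto
    also have "\<dots> \<le> emeasure lborel (?T j \<inter> K)"
      unfolding K_def by (rule tube_hit_volume_ge[OF d_def bd fin c e[OF j] R])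
    finally show "ennreal (h * (unit_ball_vol 3 * (R * d / 2)^3)) \<le> emeasure lborel (?T j \<inter> K)" .
  qed
  also have "\<dots> = (\<Sum>j\<in>J. \<integral>\<^sup>+x. indicator (?T j \<inter> K) x \<partial>lborel)"
    by (intro sum.cong refl nn_integral_indicator[symmetric]) auto
  also have "\<dots> = (\<integral>\<^sup>+x. (\<Sum>j\<in>J. indicator (?T j \<inter> K) x) \<partial>lborel)"
    by (intro nn_integral_sum[symmetric]) auto
  also have "\<dots> \<le> (\<integral>\<^sup>+x. ennreal l * indicator K x + ennreal (l powr (1 - q)) * ennreal (F x powr q) \<partial>lborel)"
  proof (intro nn_integral_mono)
    fix x
    show "(\<Sum>j\<in>J. indicator (?T j \<inter> K) x) \<le> ennreal l * indicator K x + ennreal (l powr (1 - q)) * ennreal (F x powr q)"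
    proof (cases "x \<in> K")
      case True
      have "(\<Sum>j\<in>J. indicator (?T j \<inter> K) x :: ennreal) = (\<Sum>j\<in>J. ennreal (indicator (?T j) x))"
        using True by (intro sum.cong refl) (auto simp: indicator_def)
      also have "\<dots> = ennreal (F x)" unfolding F_def by (rule sum_ennreal) auto
      also have "\<dots> \<le> ennreal (l + l powr (1 - q) * F x powr q)"
        by (intro ennreal_leI le_level_plus_power F0 l q)
      also have "\<dots> = ennreal l * indicator K x + ennreal (l powr (1 - q)) * ennreal (F x powr q)"
        using l True by (simp add: ennreal_mult')
      finally show ?thesis .
    qed simp
  qed
  also have "\<dots> = ennreal l * emeasure lborel K + ennreal (l powr (1 - q)) * (\<integral>\<^sup>+x. ennreal (F x powr q) \<partial>lborel)"
    by (subst nn_integral_add, measurable) (simp add: nn_integral_cmult)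
  also have "\<dots> \<le> ennreal l * ennreal (real (card (scale_class C k)) * (unit_ball_vol 3 * (2 * (R * d))^3))
      + ennreal (l powr (1 - q)) * ennreal A"
    using est by (intro add_mono mult_left_mono Kle) (auto simp: F_def)
  also have "\<dots> = ennreal (l * (real (card (scale_class C k)) * (unit_ball_vol 3 * (2 * (R * d))^3)) + l powr (1 - q) * A)"
    using l A R d by (subst ennreal_plus) (auto simp: ennreal_mult' intro!: mult_nonneg_nonneg)
  finally show ?thesis
    using l A R d by (subst (asm) ennreal_le_iff) (auto intro!: add_nonneg_nonneg mult_nonneg_nonneg)
qed

section \<open>The dimension bound\<close>

lemma half_power_powr: "((1/2::real)^k) powr a = ((1/2) powr a)^k"
proof -
  have "((1/2::real)^k) powr a = ((1/2) powr real k) powr a" by (simp add: powr_realpow)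
  also have "\<dots> = ((1/2) powr a) powr real k" by (simp add: powr_powr mult.commute)
  also have "\<dots> = ((1/2) powr a)^k" by (rule powr_realpow) simp
  finally show ?thesis .
qed

lemma half_powr_tendsto_0:
  assumes "0 < a"
  shows "(\<lambda>k::nat. ((1/2::real)^k) powr a) \<longlonglongrightarrow> 0"
proof -
  have "(1/2::real) powr a < 1 powr a" using assms by (intro powr_less_mono2) auto
  then have "(\<lambda>k. ((1/2::real) powr a)^k) \<longlonglongrightarrow> 0" by (intro LIMSEQ_realpow_zero) auto
  then show ?thesis unfolding half_power_powr .
qed

text \<open>
  \<open>\<beta>\<close> makes the level \<open>\<delta> powr -\<beta>\<close> and \<open>\<theta>\<close> is the loss \<open>\<delta> powr \<theta>\<close> of each of the two pigeonholings.
\<close>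

lemma Kakeya_exponents:
  fixes p\<^sub>0 s :: real
  assumes "3 \<le> p\<^sub>0" "0 < s" "s < kakeya_exponent p\<^sub>0"
  obtains p \<beta> \<theta> where "p\<^sub>0 < p" "0 < \<theta>" "0 < 3 - s - \<beta> - 2 * \<theta>" "0 < 6 - 2 * p + \<beta> * (p / 2 - 1) - 2 * \<theta>"
proof -
  \<comment> \<open>The condition on \<open>s\<close> is solved for the restriction exponent, which
    leaves room for a slightly larger \<open>p\<close>.\<close>
  have "s * (p\<^sub>0 - 2) < 6 - p\<^sub>0"
    using assms by (simp add: kakeya_exponent_def pos_less_divide_eq)
  then have "p\<^sub>0 * (s + 1) < 6 + 2 * s" by (simp add: algebra_simps)
  then have "p\<^sub>0 < (6 + 2 * s) / (s + 1)" using assms by (simp add: pos_less_divide_eq)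
  then obtain p where p: "p\<^sub>0 < p" "p < (6 + 2 * s) / (s + 1)" using dense by blast
  then have "p * (s + 1) < 6 + 2 * s" using assms by (simp add: pos_less_divide_eq)
  moreover have eq: "(3 - s) * (p / 2 - 1) - (2 * p - 6) = (6 + 2 * s - p * (s + 1)) / 2"
    by (simp add: field_simps)
  ultimately have "0 < (3 - s) * (p / 2 - 1) - (2 * p - 6)" unfolding eq by simp
  then have "2 * p - 6 < (3 - s) * (p / 2 - 1)" by simp
  moreover have q: "0 < p / 2 - 1" using p assms by simp
  ultimately have "(2 * p - 6) / (p / 2 - 1) < 3 - s" by (subst pos_divide_less_eq)
  \<comment> \<open>The lower bound on \<beta> makes the power term of the overlap bound small, and
    the upper bound does the same for the level term; the choice of \<open>p\<close> makes the two
    compatible.\<close>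
  then obtain \<beta> where \<beta>: "(2 * p - 6) / (p / 2 - 1) < \<beta>" "\<beta> < 3 - s" using dense by blast
  then have *: "2 * p - 6 < \<beta> * (p / 2 - 1)" using q by (subst (asm) pos_divide_less_eq)
  \<comment> \<open>Two pigeonholings cost \<open>2 * \<theta>\<close>, so a quarter of the smaller
    gap leaves both exponents positive.\<close>
  define \<theta> where "\<theta> = min (3 - s - \<beta>) (\<beta> * (p / 2 - 1) - (2 * p - 6)) / 4"
  have "0 < \<theta>" "4 * \<theta> \<le> 3 - s - \<beta>" "4 * \<theta> \<le> \<beta> * (p / 2 - 1) - (2 * p - 6)"
    using \<beta> * by (auto simp: \<theta>_def)
  with p(1) show thesis by (intro that[of p \<theta> \<beta>]; linarith)
qed

text \<open>If the measure vanished, a cheap cover would exist at arbitrarily fine scales. After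
  normalisation the incidence bound would keep a fixed positive constant below two positive powers
  of the scale, which fails once the scale is fine enough.\<close>

lemma Kakeya_hausdorff_measure_pos:
  assumes p: "3 \<le> p\<^sub>0" and s: "0 < s" "s < kakeya_exponent p\<^sub>0"
    and restr: "\<And>p. p\<^sub>0 < p \<Longrightarrow> \<exists>C::real. \<forall>f \<in> Lp_space p sphere_measure.
      fourier_extension (sphere 0 1) f \<in> Lp_space p lborel \<and>
      Lp_norm p lborel (fourier_extension (sphere 0 1) f) \<le> C * Lp_norm p sphere_measure f"
    and K: "Kakeya_set K"
  shows "hausdorff_measure s K \<noteq> 0"
proof
  assume zero: "hausdorff_measure s K = 0"
  obtain p \<beta> \<theta> where pp: "p\<^sub>0 < p" and \<theta>: "0 < \<theta>" and a1: "0 < 3 - s - \<beta> - 2 * \<theta>"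
    and a2: "0 < 6 - 2 * p + \<beta> * (p / 2 - 1) - 2 * \<theta>"
    using Kakeya_exponents[OF p s] by blast
  obtain L where L: "\<And>f. f \<in> Lp_space p sphere_measure \<Longrightarrow>
      fourier_extension (sphere 0 1) f \<in> Lp_space p lborel \<and>
      Lp_norm p lborel (fourier_extension (sphere 0 1) f) \<le> L * Lp_norm p sphere_measure f"
    using restr[OF pp] by blast
  define V where "V = unit_ball_vol 3"
  have V: "0 < V" by (simp add: V_def)
  define w where "w k = ((1/2::real)^k) powr \<theta>" for k :: nat
  define A\<^sub>1 A\<^sub>2 where "A\<^sub>1 = 2 powr s * (V / 64)" and "A\<^sub>2 = 16 powr p * \<bar>L\<bar> powr p"
  have "(\<lambda>k::nat. A\<^sub>1 * ((1/2)^k) powr (3 - s - \<beta> - 2 * \<theta>) + A\<^sub>2 * ((1/2)^k) powr (6 - 2 * p + \<beta> * (p / 2 - 1) - 2 * \<theta>))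
      \<longlonglongrightarrow> A\<^sub>1 * 0 + A\<^sub>2 * 0"
    by (intro tendsto_intros half_powr_tendsto_0 a1 a2)
  then have "\<forall>\<^sub>F k in sequentially. A\<^sub>1 * ((1/2)^k) powr (3 - s - \<beta> - 2 * \<theta>) + A\<^sub>2 * ((1/2)^k) powr (6 - 2 * p + \<beta> * (p / 2 - 1) - 2 * \<theta>) < V / 4096"
    using V by (intro order_tendstoD(2)) auto
  then obtain k\<^sub>1 where k1: "\<And>k. k\<^sub>1 \<le> k \<Longrightarrow>
      A\<^sub>1 * ((1/2)^k) powr (3 - s - \<beta> - 2 * \<theta>) + A\<^sub>2 * ((1/2)^k) powr (6 - 2 * p + \<beta> * (p / 2 - 1) - 2 * \<theta>) < V / 4096"
    by (auto simp: eventually_sequentially)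
  have wpos: "0 < w k" for k by (simp add: w_def)
  have summ: "summable w"
  proof -
    have "(1/2::real) powr \<theta> < 1 powr \<theta>" using \<theta> by (intro powr_less_mono2) auto
    then have "summable (\<lambda>k. ((1/2::real) powr \<theta>)^k)" by (intro summable_geometric) auto
    then show ?thesis unfolding w_def half_power_powr .
  qed
  obtain k\<^sub>2 where k2: "\<And>k. k\<^sub>2 \<le> k \<Longrightarrow> norm (\<Sum>i. w (i + k)) < 1/4"
    using suminf_exist_split[OF _ summ, of "1/4"] by auto
  \<comment> \<open>From this index on, the final inequality is violated and the tail of the weights
    is below \<open>1/4\<close>; the value is at least 1 so that cells can tile half the unit
    interval.\<close>
  define k\<^sub>0 where "k\<^sub>0 = max 1 (max k\<^sub>1 k\<^sub>2)"
  then have k0: "1 \<le> k\<^sub>0" and k01: "k\<^sub>1 \<le> k\<^sub>0" and k02: "k\<^sub>2 \<le> k\<^sub>0" by simp_all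
  have "(\<Sum>k. ennreal (w (k + k\<^sub>0))) = ennreal (\<Sum>k. w (k + k\<^sub>0))"
    using summ wpos by (intro suminf_ennreal2) (auto simp: less_imp_le summable_iff_shift)
  also have "\<dots> < ennreal (1/4)"
    using k2[of k\<^sub>0] k02 by (intro ennreal_lessI) auto
  finally have wsum: "(\<Sum>k. ennreal (w (k + k\<^sub>0))) < ennreal (1/4)" .
  have "hausdorff_content s ((1/2)^k\<^sub>0) K < 1"
    using hausdorff_content_le_measure[of "(1/2)^k\<^sub>0" s K] zero by (simp add: order_le_less_trans)
  then obtain C where C: "\<And>n. bounded (C n)" "\<And>n. diameter (C n) \<le> (1/2)^k\<^sub>0" "K \<subseteq> (\<Union>n. C n)"
      "(\<Sum>n. diam_cost s (C n)) < 1"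
    by (rule hausdorff_content_close) blast
  obtain k J b e where k: "k\<^sub>0 \<le> k" and J: "finite J"
    and cells: "\<And>i l. (i, l) \<in> J \<Longrightarrow> real (Suc i) * (1/2)^k \<le> 1/2 \<and> real (Suc l) * (1/2)^k \<le> 1/2"
    and e: "\<And>i l. (i, l) \<in> J \<Longrightarrow> e (i, l) \<in> patch (cell ((1/2)^k) i) (cell ((1/2)^k) l)"
    and cardJ: "w k < real (card J) * ((1/2)^k)^2"
    and hits: "\<And>j. j \<in> J \<Longrightarrow> w k < real (card (hit_cells C k (b j) (e j))) * (1/2)^k"
    by (rule Kakeya_scale_exists[OF K C(3) C(1,2) k0 wsum]) blast
  define d where "d = (1/2::real)^k"
  have d: "0 < d" by (simp add: d_def)
  \<comment> \<open>This is the tube length of the extension estimate. Its tube width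
    \<open>1 / (8 * d)\<close> is exactly \<open>R * d\<close>, so covering sets of diameter about
    \<open>d\<close> dilate to the width of the tubes.\<close>
  define R where "R = 1 / (8 * d^2)"
  have R: "0 < R" using d by (simp add: R_def)
  have Rd: "R * d = 1 / (8 * d)" using d by (simp add: R_def power2_eq_square)
  have e1: "norm (e j) = 1" if "j \<in> J" for j
    using e[of "fst j" "snd j"] that by (simp add: patch_def)
  define q where "q = p / 2"
  define N where "N = real (card (scale_class C k))"
  have q: "1 \<le> q" using p pp by (simp add: q_def)
  have est: "(\<integral>\<^sup>+x. ennreal ((\<Sum>j\<in>J. indicator (tube R (R * d) (b j) (e j)) x) powr q) \<partial>lborel)
      \<le> ennreal ((16 / d^2) powr p * \<bar>L\<bar> powr p)"
    unfolding Rd q_def unfolding R_def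
    by (rule restriction_imp_tube_estimate[OF _ L d J]) (use p pp cells e in \<open>auto simp: d_def\<close>)
  have hit': "w k / d \<le> real (card (hit_cells C k (b j) (e j)))" if "j \<in> J" for j
    using hits[OF that] d by (simp add: pos_divide_le_eq d_def)
  \<comment> \<open>There are at least \<open>w k / d^2\<close> tubes with at least
    \<open>w k / d\<close> hit cells each; the level in the incidence bound is
    \<open>d powr (- \<beta>)\<close>.\<close>
  have "w k / d^2 * (w k / d * (V * (R * d / 2)^3)) \<le> real (card J) * (w k / d * (V * (R * d / 2)^3))"
    using cardJ wpos[of k] d V R
    by (intro mult_right_mono) (auto simp: pos_divide_le_eq d_def[symmetric] intro!: mult_nonneg_nonneg divide_nonneg_pos)
  also have "\<dots> \<le> d powr (- \<beta>) * (N * (V * (2 * (R * d))^3)) + (d powr (- \<beta>)) powr (1 - q) * ((16 / d^2) powr p * \<bar>L\<bar> powr p)"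
    unfolding V_def N_def
    using wpos[of k] d
    by (intro tube_incidence_bound[OF d_def C(1) scale_class_card(1)[OF C(1) s(1) C(4)] J e1 R hit' _ est _ q]) auto
  also have "\<dots> \<le> d powr (- \<beta>) * ((2 / d) powr s * (V * (2 * (R * d))^3)) + (d powr (- \<beta>)) powr (1 - q) * ((16 / d^2) powr p * \<bar>L\<bar> powr p)"
    unfolding N_def d_def
    using scale_class_card(2)[OF C(1) s(1) C(4), of k] V R
    by (intro add_right_mono mult_left_mono mult_right_mono) auto
  also have "\<dots> = A\<^sub>1 * d powr (- \<beta> - s - 3) + A\<^sub>2 * d powr (\<beta> * (q - 1) - 2 * p)"
  proof -
    have "(2 / d) powr s = 2 powr s * d powr (- s)" using d by (simp add: powr_divide powr_minus_divide)
    moreover have "(2 * (R * d))^3 = d powr (- 3) / 64"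
      using d by (simp add: Rd powr_minus_divide power_divide)
    ultimately have 1: "d powr (- \<beta>) * ((2 / d) powr s * (V * (2 * (R * d))^3)) = A\<^sub>1 * (d powr (- \<beta>) * d powr (- s) * d powr (- 3))"
      by (simp add: A\<^sub>1_def)
    have "(16 / d^2) powr p = 16 powr p * d powr (- (2 * p))"
      using d by (simp add: powr_divide powr_minus_divide powr_powr flip: powr_numeral)
    moreover have "(d powr (- \<beta>)) powr (1 - q) = d powr (\<beta> * (q - 1))"
      by (simp add: powr_powr algebra_simps)
    ultimately have 2: "(d powr (- \<beta>)) powr (1 - q) * ((16 / d^2) powr p * \<bar>L\<bar> powr p) = A\<^sub>2 * (d powr (\<beta> * (q - 1)) * d powr (- (2 * p)))"
      by (simp add: A\<^sub>2_def)
    show ?thesis unfolding 1 2 powr_add[symmetric] by simp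
  qed
  \<comment> \<open>The constant 4096 is the cube of 16, since \<open>R * d / 2\<close> equals
    \<open>1 / (16 * d)\<close>. The 64 in \<open>A\<^sub>1\<close> arises likewise from
    \<open>2 * (R * d) = 1 / (4 * d)\<close>.\<close>
  also have "w k / d^2 * (w k / d * (V * (R * d / 2)^3)) = V / 4096 * d powr (2 * \<theta> - 6)"
  proof -
    have "w k = d powr \<theta>" by (simp only: w_def d_def)
    moreover have "d powr (2 * \<theta> - 6) = d powr \<theta> * d powr \<theta> / d powr 6"
      by (simp only: powr_diff mult_2 powr_add)
    moreover have "d powr 6 = d^6" using d by (simp add: powr_numeral)
    ultimately have pw: "d powr (2 * \<theta> - 6) = w k * w k / d^6" by simp
    have vol: "(R * d / 2)^3 = 1 / (4096 * d^3)" by (simp add: Rd power_divide power_mult_distrib)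
    show ?thesis unfolding pw vol using d by (simp add: field_simps eval_nat_numeral)
  qed
  finally have ineq: "V / 4096 * d powr (2 * \<theta> - 6)
      \<le> A\<^sub>1 * d powr (- \<beta> - s - 3) + A\<^sub>2 * d powr (\<beta> * (q - 1) - 2 * p)" .
  \<comment> \<open>Multiplying by \<open>d powr (6 - 2 * \<theta>)\<close> frees the left side of
    \<open>d\<close> and turns the right side into the two powers already known to be small.\<close>
  have exps: "d powr (2 * \<theta> - 6) * d powr (6 - 2 * \<theta>) = 1"
    "d powr (- \<beta> - s - 3) * d powr (6 - 2 * \<theta>) = d powr (3 - s - \<beta> - 2 * \<theta>)"
    "d powr (\<beta> * (q - 1) - 2 * p) * d powr (6 - 2 * \<theta>) = d powr (6 - 2 * p + \<beta> * (p / 2 - 1) - 2 * \<theta>)"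
    unfolding powr_add[symmetric] q_def using d by (simp_all add: algebra_simps)
  have "V / 4096 * d powr (2 * \<theta> - 6) * d powr (6 - 2 * \<theta>)
      \<le> (A\<^sub>1 * d powr (- \<beta> - s - 3) + A\<^sub>2 * d powr (\<beta> * (q - 1) - 2 * p)) * d powr (6 - 2 * \<theta>)"
    using ineq by (rule mult_right_mono) simp
  then have "V / 4096 \<le> A\<^sub>1 * d powr (3 - s - \<beta> - 2 * \<theta>) + A\<^sub>2 * d powr (6 - 2 * p + \<beta> * (p / 2 - 1) - 2 * \<theta>)"
    unfolding distrib_right mult.assoc exps by simp
  then show False using k1[OF order_trans[OF k01 k]] by (simp add: d_def)
qed

text \<open>At exponent 0 every nonempty covering set costs 1, so a cover of cost below 1 consists
  of empty sets, whereas a Kakeya set contains a segment.\<close>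

lemma Kakeya_hausdorff_measure_0:
  assumes "Kakeya_set K"
  shows "hausdorff_measure 0 K \<noteq> 0"
proof
  assume "hausdorff_measure 0 K = 0"
  then have "hausdorff_content 0 1 K < 1"
    using hausdorff_content_le_measure[of 1 0 K] by (simp add: order_le_less_trans)
  then obtain C where C: "K \<subseteq> (\<Union>n. C n)" "(\<Sum>n. diam_cost 0 (C n)) < 1"
    by (rule hausdorff_content_close) blast
  have "C n = {}" for n
  proof (rule ccontr)
    assume "C n \<noteq> {}"
    then have "1 = (\<Sum>n\<in>{n}. diam_cost 0 (C n))" by (simp add: diam_cost_def)
    also have "\<dots> \<le> (\<Sum>n. diam_cost 0 (C n))" by (intro sum_le_suminf summableI) auto
    finally show False using C(2) by simp
  qed
  then have "K = {}" using C(1) by auto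
  moreover have "norm (axis 1 1 :: real^3) = 1" by (simp add: norm_axis_1)
  then obtain a :: "real^3" where "closed_segment a (a + axis 1 1) \<subseteq> K"
    using assms unfolding Kakeya_set_def by blast
  ultimately show False by auto
qed

theorem lemma6p1:
  shows "(\<forall>p\<^sub>0::real. p\<^sub>0 \<ge> 3 \<longrightarrow>
           (\<forall>S. compact S \<and> C2_surface S \<and> positive_second_fundamental_form S \<longrightarrow>
              (\<forall>p>p\<^sub>0. \<exists>C::real. \<forall>f \<in> Lp_space p (surface_measure S).
                 fourier_extension S f \<in> Lp_space p lborel \<and>
                 Lp_norm p lborel (fourier_extension S f) \<le> C * Lp_norm p (surface_measure S) f)) \<longrightarrow>
           (\<forall>K. Kakeya_set K \<longrightarrow> hausdorff_dim K \<ge> ereal (kakeya_exponent p\<^sub>0)))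
         \<and> kakeya_exponent (22 / 7) = 5 / 2 \<and> kakeya_exponent (3.2) = 7 / 3"
proof (intro conjI allI impI)
  fix p\<^sub>0 :: real and K
  assume p: "3 \<le> p\<^sub>0" and K: "Kakeya_set K"
    and H: "\<forall>S. compact S \<and> C2_surface S \<and> positive_second_fundamental_form S \<longrightarrow>
      (\<forall>p>p\<^sub>0. \<exists>C::real. \<forall>f \<in> Lp_space p (surface_measure S).
         fourier_extension S f \<in> Lp_space p lborel \<and>
         Lp_norm p lborel (fourier_extension S f) \<le> C * Lp_norm p (surface_measure S) f)"
  \<comment> \<open>The unit sphere is the only surface to which the hypothesis is applied.\<close>
  have restr: "\<exists>C::real. \<forall>f \<in> Lp_space p sphere_measure.
      fourier_extension (sphere 0 1) f \<in> Lp_space p lborel \<and>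
      Lp_norm p lborel (fourier_extension (sphere 0 1) f) \<le> C * Lp_norm p sphere_measure f" if "p\<^sub>0 < p" for p
    by (rule H[rule_format, OF _ that])
      (simp add: C2_surface_sphere positive_second_fundamental_form_sphere)
  show "ereal (kakeya_exponent p\<^sub>0) \<le> hausdorff_dim K"
    unfolding hausdorff_dim_def
  proof (intro Inf_greatest)
    fix x assume "x \<in> {ereal s |s. 0 \<le> s \<and> hausdorff_measure s K = 0}"
    then obtain s where s: "x = ereal s" "0 \<le> s" "hausdorff_measure s K = 0" by blast
    have "kakeya_exponent p\<^sub>0 \<le> s"
      using Kakeya_hausdorff_measure_pos[OF p _ _ restr K, of s] Kakeya_hausdorff_measure_0[OF K] s
      by (cases "s = 0") (auto simp: not_less[symmetric])
    then show "ereal (kakeya_exponent p\<^sub>0) \<le> x" by (simp add: s(1))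
  qed
qed (simp_all add: kakeya_exponent_def)

end
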